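(* Let $q$ be a prime power and let $n$ and $t>1$ be integers with $n\ge 2t$. Then $\tau_q(n+t-1,t)=\sigma_q(n,t)$.
   Context: $V(n,q)$ denotes the $n$-dimensional vector space over the finite field with $q$ elements. A subspace partition of $V(n,q)$ is a collection of subspaces such that every $1$-dimensional subspace is contained in exactly one member; its size is the number of its members. $\sigma_q(n,t)$ denotes the minimum size of a subspace partition of $V(n,q)$ in which the largest subspace has dimension $t$. A partial $t$-spread of $V(m,q)$ is a collection of $t$-dimensional subspaces pairwise intersecting only in $\{0\}$; it is maximal if it cannot be extended to a larger partial $t$-spread. $\tau_q(m,t)$ denotes the minimum number of subspaces in a maximal partial $t$-spread of $V(m,q)$. *)

theory Defs
  imports
    Complex_Main
    "HOL-Library.Function_Algebras"
    "HOL-Library.Cardinality"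
    "HOL-Number_Theory.Prime_Powers"
begin

definition fscale :: "'a::field \<Rightarrow> (nat \<Rightarrow> 'a) \<Rightarrow> nat \<Rightarrow> 'a" where
  "fscale c v = (\<lambda>i. c * v i)"

global_interpretation fvs: vector_space fscale
  by unfold_locales (auto simp: fscale_def fun_eq_iff algebra_simps)

(* V(n,q) with q = CARD('a), realised inside a single type for all n: a vector with n
   coordinates is a function vanishing from index n on. *)
definition coord_space :: "nat \<Rightarrow> (nat \<Rightarrow> 'a::field) set" where
  "coord_space n = {v. \<forall>i\<ge>n. v i = 0}"

definition subspaces_of :: "(nat \<Rightarrow> 'a::field) set \<Rightarrow> (nat \<Rightarrow> 'a) set set" where
  "subspaces_of V = {W. fvs.subspace W \<and> W \<subseteq> V}"

(* The zero subspace is allowed as a member; since removing it leaves a partition, this does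
   not affect the minimum size. *)
definition subspace_partition :: "nat \<Rightarrow> (nat \<Rightarrow> 'a::field) set set \<Rightarrow> bool" where
  "subspace_partition n P \<longleftrightarrow>
     P \<subseteq> subspaces_of (coord_space n) \<and>
     (\<forall>L \<in> subspaces_of (coord_space n). fvs.dim L = 1 \<longrightarrow> (\<exists>!W. W \<in> P \<and> L \<subseteq> W))"

definition largest_dim :: "(nat \<Rightarrow> 'a::field) set set \<Rightarrow> nat \<Rightarrow> bool" where
  "largest_dim P t \<longleftrightarrow> (\<exists>W\<in>P. fvs.dim W = t) \<and> (\<forall>W\<in>P. fvs.dim W \<le> t)"

definition sigma :: "'a::{field,finite} itself \<Rightarrow> nat \<Rightarrow> nat \<Rightarrow> nat" where
  "sigma _ n t =
     (LEAST k. \<exists>P :: (nat \<Rightarrow> 'a) set set. subspace_partition n P \<and> largest_dim P t \<and> card P = k)"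

definition partial_spread :: "nat \<Rightarrow> nat \<Rightarrow> (nat \<Rightarrow> 'a::field) set set \<Rightarrow> bool" where
  "partial_spread m t S \<longleftrightarrow>
     S \<subseteq> {W \<in> subspaces_of (coord_space m). fvs.dim W = t} \<and>
     (\<forall>U\<in>S. \<forall>W\<in>S. U \<noteq> W \<longrightarrow> U \<inter> W = {0})"

definition maximal_partial_spread :: "nat \<Rightarrow> nat \<Rightarrow> (nat \<Rightarrow> 'a::field) set set \<Rightarrow> bool" where
  "maximal_partial_spread m t S \<longleftrightarrow>
     partial_spread m t S \<and> (\<nexists>S'. partial_spread m t S' \<and> S \<subset> S')"

definition tau :: "'a::{field,finite} itself \<Rightarrow> nat \<Rightarrow> nat \<Rightarrow> nat" where
  "tau _ m t =
     (LEAST k. \<exists>S :: (nat \<Rightarrow> 'a) set set. maximal_partial_spread m t S \<and> card S = k)"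

lemma subspace_coord_space: "fvs.subspace (coord_space n)"
  by (auto simp: fvs.subspace_def coord_space_def fscale_def)

lemma finite_coord_space: "finite (coord_space n :: (nat \<Rightarrow> 'a::{field,finite}) set)"
proof -
  have "inj_on (\<lambda>v. map v [0..<n]) (coord_space n :: (nat \<Rightarrow> 'a) set)"
    by (force simp: inj_on_def coord_space_def fun_eq_iff not_le[symmetric])
  moreover have "(\<lambda>v. map v [0..<n]) ` (coord_space n :: (nat \<Rightarrow> 'a) set)
      \<subseteq> {xs. set xs \<subseteq> UNIV \<and> length xs = n}" by auto
  ultimately show ?thesis
    using finite_lists_length_eq[of "UNIV :: 'a set" n] by (meson finite_imageD finite_subset finite)
qed

definition unit_fun :: "nat \<Rightarrow> nat \<Rightarrow> 'a::field" where
  "unit_fun i = (\<lambda>j. if j = i then 1 else 0)"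

lemma sum_unit_fun: "(\<Sum>i<n. fscale (c i) (unit_fun i)) = (\<lambda>j. if j < n then c j else 0)"
  by (induction n) (auto simp: fscale_def unit_fun_def fun_eq_iff less_Suc_eq)

lemma dim_coord_space: "fvs.dim (coord_space n :: (nat \<Rightarrow> 'a::field) set) = n"
proof -
  let ?B = "(unit_fun :: nat \<Rightarrow> nat \<Rightarrow> 'a) ` {..<n}"
  have inj: "inj (unit_fun :: nat \<Rightarrow> nat \<Rightarrow> 'a)"
    unfolding inj_def unit_fun_def by (metis zero_neq_one)
  have ind: "fvs.independent ?B"
  proof (rule fvs.independent_if_scalars_zero)
    fix f :: "(nat \<Rightarrow> 'a) \<Rightarrow> 'a" and x
    assume s: "(\<Sum>x\<in>?B. fscale (f x) x) = 0" and x: "x \<in> ?B"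
    have "(\<Sum>i<n. fscale (f (unit_fun i)) (unit_fun i)) = (0 :: nat \<Rightarrow> 'a)"
      using s inj by (simp add: sum.reindex inj_on_def)
    hence "\<forall>j. (if j < n then f (unit_fun j) else 0) = 0"
      unfolding sum_unit_fun by (simp add: fun_eq_iff)
    thus "f x = 0" using x by (metis imageE lessThan_iff)
  qed simp
  have "coord_space n \<subseteq> fvs.span ?B"
  proof
    fix v :: "nat \<Rightarrow> 'a" assume "v \<in> coord_space n"
    hence "v = (\<Sum>i<n. fscale (v i) (unit_fun i))"
      unfolding sum_unit_fun by (auto simp: coord_space_def fun_eq_iff)
    also have "\<dots> \<in> fvs.span ?B"
      by (intro fvs.span_sum fvs.span_scale fvs.span_base) auto
    finally show "v \<in> fvs.span ?B" .
  qed
  moreover have "?B \<subseteq> coord_space n" by (auto simp: coord_space_def unit_fun_def)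
  ultimately show ?thesis
    using ind inj by (intro fvs.dim_unique[of ?B]) (auto simp: card_image inj_on_def)
qed

text \<open>Both minima are taken over nonempty families.\<close>

lemma ex_maximal_partial_spread:
  "\<exists>S :: (nat \<Rightarrow> 'a::{field,finite}) set set. maximal_partial_spread m t S"
proof -
  let ?A = "{S :: (nat \<Rightarrow> 'a) set set. partial_spread m t S}"
  have "?A \<subseteq> Pow (Pow (coord_space m))"
    by (auto simp: partial_spread_def subspaces_of_def)
  hence "finite ?A" using finite_coord_space by (meson finite_Pow_iff finite_subset)
  moreover have "{} \<in> ?A" by (simp add: partial_spread_def)
  ultimately obtain S where "S \<in> ?A" "\<forall>S'\<in>?A. S \<subseteq> S' \<longrightarrow> S = S'"
    using finite_has_maximal[of ?A] by blast
  thus ?thesis unfolding maximal_partial_spread_def by blast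
qed

lemma dim_one_eq_span:
  assumes "fvs.subspace L" "fvs.dim L = 1"
  obtains v where "v \<noteq> 0" "L = fvs.span {v}"
proof -
  obtain B where B: "B \<subseteq> L" "fvs.independent B" "L \<subseteq> fvs.span B" "card B = fvs.dim L"
    using fvs.basis_exists by blast
  then obtain v where v: "B = {v}" using assms(2) by (metis card_1_singletonE)
  hence "v \<noteq> 0" using B(2) fvs.dependent_zero by blast
  moreover have "fvs.span B \<subseteq> L" using B(1) assms(1) by (rule fvs.span_minimal)
  ultimately show ?thesis using that[of v] B(3) v by simp
qed

lemma dim_span_singleton: "v \<noteq> 0 \<Longrightarrow> fvs.dim (fvs.span {v}) = 1"
  by (subst fvs.dim_span_eq_card_independent) auto

lemma span_singleton_eq:
  assumes "w \<in> fvs.span {v}" "w \<noteq> 0"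
  shows "fvs.span {w} = fvs.span {v}"
proof -
  obtain k where k: "w = fscale k v" using assms(1) fvs.span_singleton by auto
  hence "k \<noteq> 0" using assms(2) by auto
  hence "v = fscale (inverse k) w" using k by simp
  hence "v \<in> fvs.span {w}" by (metis fvs.span_base fvs.span_scale insertI1)
  thus ?thesis using assms(1)
    by (intro equalityI fvs.span_minimal) auto
qed

lemma ex_subspace_partition:
  assumes "1 \<le> t" "t \<le> n"
  shows "\<exists>P :: (nat \<Rightarrow> 'a::field) set set. subspace_partition n P \<and> largest_dim P t"
proof -
  let ?T = "coord_space t :: (nat \<Rightarrow> 'a) set"
  let ?P = "insert ?T ((\<lambda>v. fvs.span {v}) ` (coord_space n - ?T))"
  have T: "?T \<subseteq> coord_space n" using assms(2) by (auto simp: coord_space_def)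
  have zero: "0 \<in> ?T" by (simp add: coord_space_def)
  have sub: "fvs.span {v} \<subseteq> coord_space n" if "v \<in> coord_space n" for v :: "nat \<Rightarrow> 'a" and n
    using that by (intro fvs.span_minimal subspace_coord_space) auto
  have "\<exists>!W. W \<in> ?P \<and> L \<subseteq> W"
    if L: "L \<in> subspaces_of (coord_space n)" "fvs.dim L = 1" for L
  proof -
    obtain v where v: "v \<noteq> 0" "L = fvs.span {v}"
      using L dim_one_eq_span unfolding subspaces_of_def by blast
    have vL: "v \<in> L" unfolding v(2) by (simp add: fvs.span_base)
    have vn: "v \<in> coord_space n" using vL L(1) by (auto simp: subspaces_of_def)
    have line: "W = L \<and> v \<notin> ?T" if W: "W \<in> ?P" "L \<subseteq> W" "W \<noteq> ?T" for W
    proof -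
      obtain w where w: "W = fvs.span {w}" "w \<notin> ?T" using W(1,3) by auto
      have e: "fvs.span {v} = fvs.span {w}" using span_singleton_eq[of v w] vL W(2) w(1) v(1) by auto
      have "v \<notin> ?T" using sub[of v t] e w(2) fvs.span_base[of w "{w}"] by auto
      thus ?thesis using e w(1) v(2) by simp
    qed
    show ?thesis
    proof (cases "v \<in> ?T")
      case True
      hence "L \<subseteq> ?T" using sub v(2) by simp
      thus ?thesis using line True by (intro ex1I[of _ ?T]) auto
    next
      case False
      hence "\<not> L \<subseteq> ?T" "L \<in> ?P" using vL vn v(2) by auto
      thus ?thesis using line by (intro ex1I[of _ L]) blast+
    qed
  qed
  hence "\<forall>L \<in> subspaces_of (coord_space n). fvs.dim L = 1 \<longrightarrow> (\<exists>!W. W \<in> ?P \<and> L \<subseteq> W)"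
    by (intro ballI impI)
  moreover have "?P \<subseteq> subspaces_of (coord_space n)"
    using T sub by (auto simp: subspaces_of_def subspace_coord_space)
  ultimately have "subspace_partition n ?P" unfolding subspace_partition_def by (intro conjI)
  moreover have dim_le: "fvs.dim W \<le> t" if "W \<in> ?P" for W
  proof (cases "W = ?T")
    case False
    with that have "W \<in> (\<lambda>v. fvs.span {v}) ` (coord_space n - ?T)" by (simp only: insert_iff) simp
    then obtain w where w: "W = fvs.span {w}" "w \<notin> ?T" by (elim imageE DiffE)
    hence "fvs.dim W = 1" using zero by (metis dim_span_singleton)
    thus ?thesis using assms(1) by simp
  qed (simp add: dim_coord_space)
  have "largest_dim ?P t" unfolding largest_dim_def
    by (intro conjI ballI dim_le bexI[of _ ?T] dim_coord_space insertI1)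
  ultimately show ?thesis by (intro exI conjI)
qed

end

theory Submission
  imports
    "HOL-Algebra.Algebraic_Closure_Type"
    "HOL-Library.Product_Plus"
    "HOL-Library.Set_Algebras"
    Defs
begin

text \<open>Write \<open>V\<close> for \<open>V(n,q)\<close> and \<open>E\<close> for \<open>V(n+t-1,q)\<close>, so that every \<open>t\<close>-dimensional subspace of \<open>E\<close> meets
  \<open>V\<close> nontrivially. Both inequalities rest on an explicit partition \<open>P\<close> of \<open>V\<close> with largest dimension
  \<open>t\<close> and
  \<open>(card P - 1) (q^t - 1) \<le> q^n + q^(n-1) - q^(n-2) - q^t\<close>,
  obtained by repeatedly splitting a space of dimension \<open>a + b\<close> with \<open>b \<le> a\<close> into one subspace of
  dimension \<open>a\<close> and \<open>q^a\<close> subspaces of dimension \<open>b\<close>, namely the graphs of the multiplications by the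
  elements of the field with \<open>q^a\<close> elements.

  \<open>tau \<le> sigma\<close>: by counting, a smallest partition of \<open>V\<close> has at most \<open>q^(n-t-1)\<close> members of
  dimension less than \<open>t\<close>. Hence there is room in \<open>E\<close> to enlarge each of them to dimension \<open>t\<close> without
  new intersections among the members or with \<open>V\<close>. The resulting partial spread is maximal because its
  union contains \<open>V\<close>.

  \<open>sigma \<le> tau\<close>: the union of a maximal partial spread meets every \<open>t\<close>-dimensional subspace of \<open>E\<close>. If
  the spread had fewer than \<open>sigma\<close> members, this blocking set would be so small that it has to contain
  an \<open>n\<close>-dimensional subspace \<open>N\<close>, a stability version of the Bose-Burton theorem. Then the spread cuts
  out a partition of \<open>N\<close>, which has at least \<open>sigma\<close> members.\<close>

section \<open>Counting in vector spaces over finite fields\<close>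

text \<open>One round of a greedy choice: \<open>M\<close> and \<open>Q\<close> are the sizes of the
  whole space and of the current subspace, \<open>b\<close> and \<open>c\<close> the numbers of
  vectors of a given set in them, and \<open>g\<close> the number gained. After multiplication by
  \<open>M - Q\<close> the bound on \<open>g\<close> leaves \<open>c\<close> with the nonnegative
  factor \<open>M - q * Q\<close>, so the bound on \<open>c\<close> can be inserted.\<close>

lemma greedy_density_step:
  fixes b c g q Q M :: int
  assumes "c * (M - 1) \<le> b * (Q - 1)" "g * (M - Q) \<le> (b - c) * ((q - 1) * Q)"
    and "q * Q \<le> M" "Q < M" "1 \<le> M"
  shows "(c + g) * (M - 1) \<le> b * (q * Q - 1)"
proof -
  have "g * (M - Q) * (M - 1) \<le> (b - c) * ((q - 1) * Q) * (M - 1)"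
    using assms(2,5) by (intro mult_right_mono) auto
  moreover have "c * (M - 1) * (M - q * Q) \<le> b * (Q - 1) * (M - q * Q)"
    using assms(1,3) by (intro mult_right_mono) auto
  ultimately have "(c + g) * (M - 1) * (M - Q) \<le> b * (q * Q - 1) * (M - Q)"
    by (simp add: algebra_simps)
  thus ?thesis using assms(4) by (simp add: mult_right_le_imp_le)
qed

text \<open>For \<open>Q\<close> equal to q^(n-1) the conclusion is the exact negation of the size
  bound imposed on a blocking set with \<open>b\<close> vectors.\<close>

lemma pencil_bound_arith:
  fixes q Q w b :: nat
  assumes "1 \<le> q" "1 \<le> Q" "(q + 1) * ((q - 1) * Q) \<le> q * w" "w + (Q - 1) \<le> b"
  shows "q * q * Q + q * Q \<le> q * b + q + Q"
proof -
  obtain p R where pR: "q = Suc p" "Q = Suc R"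
    using assms(1,2) by (metis Suc_le_D One_nat_def)
  have "q * (w + R) \<le> q * b" using assms(4) pR by (intro mult_left_mono) auto
  thus ?thesis using assms(3) unfolding pR by (simp add: algebra_simps)
qed

lemma card_set_plus_le:
  assumes "finite S" "finite T"
  shows "card (S + T) \<le> card S * card T"
  unfolding set_plus_image
  using card_image_le[of "S \<times> T" "\<lambda>(x, y). x + y"] assms by (simp add: card_cartesian_product)

text \<open>The scalar multiplication stays abstract because the counting is applied to three
  spaces: coordinate functions, the algebraic closure and its square.\<close>

locale finite_field_vector_space = vector_space scale
  for scale :: "'a::{field,finite} \<Rightarrow> 'b::ab_group_add \<Rightarrow> 'b" (infixr "*s" 75)
begin

lemma card_field_ge_2: "2 \<le> CARD('a)"
proof -
  have "card {0, 1 :: 'a} \<le> CARD('a)" by (rule card_mono) auto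
  thus ?thesis by simp
qed

lemma span_insert_subspace:
  assumes "subspace T"
  shows "span (insert v T) = (\<lambda>(k, x). k *s v + x) ` (UNIV \<times> T)"
proof -
  have "x \<in> span (insert v T) \<longleftrightarrow> (\<exists>k. x - k *s v \<in> T)" for x
    unfolding span_breakdown_eq using assms by (simp add: span_eq_iff[THEN iffD2])
  moreover have "(\<exists>k. x - k *s v \<in> T) \<longleftrightarrow> x \<in> (\<lambda>(k, x). k *s v + x) ` (UNIV \<times> T)" for x
  proof
    assume "\<exists>k. x - k *s v \<in> T"
    then obtain k where "x - k *s v \<in> T" by blast
    thus "x \<in> (\<lambda>(k, x). k *s v + x) ` (UNIV \<times> T)"
      by (intro image_eqI[of _ _ "(k, x - k *s v)"]) auto
  next
    assume "x \<in> (\<lambda>(k, x). k *s v + x) ` (UNIV \<times> T)"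
    then obtain k y where "x = k *s v + y" "y \<in> T" by (auto simp: case_prod_beta)
    thus "\<exists>k. x - k *s v \<in> T" by (intro exI[of _ k]) simp
  qed
  ultimately show ?thesis by blast
qed

lemma inj_on_span_insert_subspace:
  assumes "subspace T" "v \<notin> T"
  shows "inj_on (\<lambda>(k, x). k *s v + x) (UNIV \<times> T)"
proof -
  have "k = l" if e: "k *s v + x = l *s v + y" and "x \<in> T" "y \<in> T" for k l x y
  proof (rule ccontr)
    assume "k \<noteq> l"
    have "(k - l) *s v = y - x" using e by (simp add: algebra_simps)
    hence "(k - l) *s v \<in> T" using assms(1) that by (simp add: subspace_diff)
    hence "inverse (k - l) *s ((k - l) *s v) \<in> T" using assms(1) subspace_scale by blast
    thus False using \<open>k \<noteq> l\<close> assms(2) by simp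
  qed
  thus ?thesis unfolding inj_on_def by force
qed

lemma card_span_insert_subspace:
  assumes "subspace T" "v \<notin> T"
  shows "card (span (insert v T)) = CARD('a) * card T"
  unfolding span_insert_subspace[OF assms(1)]
  by (simp add: card_image[OF inj_on_span_insert_subspace[OF assms]] card_cartesian_product)

lemma finite_span_insert_subspace:
  assumes "subspace T" "finite T"
  shows "finite (span (insert v T))"
  unfolding span_insert_subspace[OF assms(1)] using assms(2) by simp

lemma span_insert_span: "span (insert v (span B)) = span (insert v B)"
  unfolding set_eq_iff span_breakdown_eq span_span by simp

lemma card_span_independent:
  assumes "finite B" "independent B"
  shows "finite (span B) \<and> card (span B) = CARD('a) ^ card B"
  using assms
proof (induction B rule: finite_induct)
  case (insert b B)
  have b: "b \<notin> span B" "independent B"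
    using insert.prems insert.hyps by (simp_all add: independent_insert)
  show ?case
    using card_span_insert_subspace[OF subspace_span b(1)] insert b(2)
      finite_span_insert_subspace[OF subspace_span, of B b]
    by (simp add: span_insert_span)
qed simp

lemma finite_subspace_basis:
  assumes "subspace V" "finite V"
  obtains B where "B \<subseteq> V" "finite B" "independent B" "span B = V" "card B = dim V"
proof -
  obtain B where B: "B \<subseteq> V" "independent B" "V \<subseteq> span B" "card B = dim V"
    using basis_exists by blast
  moreover have "span B = V" using B assms by (simp add: span_minimal subset_antisym)
  ultimately show ?thesis using that assms finite_subset by blast
qed

lemma card_subspace:
  assumes "subspace V" "finite V"
  shows "card V = CARD('a) ^ dim V"
  proof -
  obtain B where "finite B" "independent B" "span B = V" "card B = dim V"
    using finite_subspace_basis[OF assms] by metis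
  thus ?thesis using card_span_independent[of B] by simp
qed

lemma dim_eqI_card:
  assumes "subspace V" "finite V" "card V = CARD('a) ^ k"
  shows "dim V = k"
  using assms card_subspace[OF assms(1,2)] card_field_ge_2 by (simp add: power_inject_exp)

lemma dim_zero_subspace: "dim {0} = 0"
  by (intro dim_eqI_card) (simp_all add: subspace_single_0)

lemma dim_span_insert_subspace:
  assumes "subspace T" "finite T" "v \<notin> T"
  shows "dim (span (insert v T)) = Suc (dim T)"
  using assms(2,3) card_span_insert_subspace[OF assms(1,3)] card_subspace[OF assms(1,2)]
    finite_span_insert_subspace[OF assms(1,2)]
  by (intro dim_eqI_card) simp_all

lemma dim_subspace_mono:
  assumes "subspace U" "subspace V" "finite V" "U \<subseteq> V"
  shows "dim U \<le> dim V"
proof -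
  have "finite U" using assms finite_subset by blast
  hence "CARD('a) ^ dim U \<le> CARD('a) ^ dim V"
    using card_mono[OF assms(3,4)] card_subspace[OF assms(1)] card_subspace[OF assms(2,3)] by simp
  thus ?thesis using card_field_ge_2 by (simp add: power_increasing_iff)
qed

lemma subspace_eqI_dim:
  assumes "subspace U" "subspace V" "finite V" "U \<subseteq> V" "dim V \<le> dim U"
  shows "U = V"
proof -
  have "dim U = dim V" using assms dim_subspace_mono by (simp add: le_antisym)
  moreover have "finite U" using assms finite_subset by blast
  ultimately have "card U = card V"
    using card_subspace[OF assms(1)] card_subspace[OF assms(2,3)] by simp
  thus ?thesis by (rule card_subset_eq[OF assms(3,4)])
qed

lemma subspace_dim_less:
  assumes "subspace U" "subspace V" "finite V" "U \<subseteq> V" "dim U < dim V"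
  obtains v where "v \<in> V" "v \<notin> U"
proof -
  have "\<not> V \<subseteq> U" using assms(4,5) by auto
  thus ?thesis using that by blast
qed

lemma subspace_between:
  assumes "subspace U" "subspace V" "finite V" "U \<subseteq> V" "dim U \<le> k" "k \<le> dim V"
  obtains Z where "subspace Z" "U \<subseteq> Z" "Z \<subseteq> V" "dim Z = k"
proof -
  have "\<exists>Z. subspace Z \<and> U \<subseteq> Z \<and> Z \<subseteq> V \<and> dim Z = k"
    using assms(5,6)
  proof (induction k rule: dec_induct)
    case base
    show ?case using assms by blast
  next
    case (step n)
    then obtain Z where Z: "subspace Z" "U \<subseteq> Z" "Z \<subseteq> V" "dim Z = n" by auto
    have less: "dim Z < dim V" and fin: "finite Z"
      using Z(3,4) step.hyps step.prems assms(3) by (auto intro: finite_subset)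
    obtain v where v: "v \<in> V" "v \<notin> Z"
      using subspace_dim_less[OF Z(1) assms(2,3) Z(3) less] by metis
    have "dim (span (insert v Z)) = Suc n"
      using dim_span_insert_subspace[OF Z(1) fin v(2)] Z(4) by simp
    moreover have "U \<subseteq> span (insert v Z)" using Z(2) span_superset[of "insert v Z"] by blast
    moreover have "span (insert v Z) \<subseteq> V" using v(1) Z(3) assms(2) by (intro span_minimal) simp_all
    ultimately show ?case using subspace_span by blast
  qed
  thus ?thesis using that by blast
qed

text \<open>Exchange makes "lies in the span of \<open>T\<close> and" a symmetric relation outside
  \<open>T\<close>, so that the sets \<open>span (insert v T) - T\<close> are equivalence
  classes.\<close>

lemma span_insert_exchange:
  assumes "subspace T" "x \<in> span (insert v T)" "x \<notin> T"
  shows "span (insert x T) = span (insert v T)"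
proof -
  have "v \<in> span (insert x T)"
    using in_span_insert[OF assms(2)] assms(1,3) by (simp add: span_eq_iff[THEN iffD2])
  hence "span (insert v T) \<subseteq> span (insert x T)"
    by (intro span_minimal) (auto intro: span_base)
  moreover have "span (insert x T) \<subseteq> span (insert v T)"
    using assms(2) by (intro span_minimal) (auto intro: span_base)
  ultimately show ?thesis by simp
qed

text \<open>The sets \<open>span (insert v T) - T\<close> with \<open>v \<notin> T\<close> are the points of the quotient by \<open>T\<close>; summing
  over all \<open>v\<close> instead of over the classes counts every class with a constant multiplicity.\<close>

lemma sum_card_Int_classes:
  assumes T: "subspace T" "finite T" and Y: "finite Y" "A \<subseteq> Y" "Y \<inter> T = {}"
    and closed: "\<And>v. v \<in> Y \<Longrightarrow> span (insert v T) - T \<subseteq> Y"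
  shows "(\<Sum>v\<in>Y. card (A \<inter> (span (insert v T) - T))) = card A * ((CARD('a) - 1) * card T)"
proof -
  let ?C = "\<lambda>v. span (insert v T) - T"
  have finA: "finite A" using Y finite_subset by blast
  \<comment> \<open>By symmetry of the relation, the number of \<open>v\<close> whose class contains
    \<open>x\<close> is the size of the class of \<open>x\<close>, which does not depend on
    \<open>x\<close>.\<close>
  have swap: "v \<in> Y \<and> x \<in> ?C v \<longleftrightarrow> v \<in> ?C x" if "x \<in> A" for x v
  proof
    assume v: "v \<in> Y \<and> x \<in> ?C v"
    hence "v \<notin> T" "span (insert x T) = span (insert v T)"
      using Y span_insert_exchange[OF T(1), of x v] by blast+
    thus "v \<in> ?C x" using span_base[of v "insert v T"] by simp
  next
    assume v: "v \<in> ?C x"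
    moreover have "x \<in> Y" "x \<notin> T" using Y that by blast+
    moreover have "span (insert v T) = span (insert x T)"
      using v span_insert_exchange[OF T(1), of v x] by blast
    ultimately show "v \<in> Y \<and> x \<in> ?C v" using closed span_base[of x "insert x T"] by auto
  qed
  have "(\<Sum>v\<in>Y. card (A \<inter> ?C v)) = (\<Sum>v\<in>Y. \<Sum>x\<in>A. if x \<in> ?C v then 1 else 0)"
    using finA by (simp add: sum.If_cases Int_def)
  also have "\<dots> = (\<Sum>x\<in>A. \<Sum>v\<in>Y. if x \<in> ?C v then 1 else 0)" by (rule sum.swap)
  also have "\<dots> = (\<Sum>x\<in>A. card (?C x))"
  proof (rule sum.cong)
    fix x assume x: "x \<in> A"
    have "(\<Sum>v\<in>Y. if x \<in> ?C v then 1 else 0) = card {v\<in>Y. x \<in> ?C v}"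
      using Y by (simp add: sum.If_cases Int_def)
    also have "{v\<in>Y. x \<in> ?C v} = ?C x" using swap[OF x] by blast
    finally show "(\<Sum>v\<in>Y. if x \<in> ?C v then 1 else 0) = card (?C x)" .
  qed simp
  also have "\<dots> = (\<Sum>x\<in>A. (CARD('a) - 1) * card T)"
  proof (rule sum.cong)
    fix x assume "x \<in> A"
    hence "x \<notin> T" using Y by blast
    moreover have "T \<subseteq> span (insert x T)" by (auto intro: span_base)
    ultimately show "card (?C x) = (CARD('a) - 1) * card T"
      using T card_span_insert_subspace[OF T(1)] by (simp add: card_Diff_subset diff_mult_distrib)
  qed simp
  finally show ?thesis by simp
qed

section \<open>Small blocking sets\<close>

lemma card_point:
  assumes "v \<noteq> 0"
  shows "card (span (insert v {0}) - {0}) = CARD('a) - 1" "finite (span (insert v {0}))"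
proof -
  have "card (span (insert v {0})) = CARD('a)" "finite (span (insert v {0}))"
    using card_span_insert_subspace[OF subspace_single_0, of v] assms
      finite_span_insert_subspace[OF subspace_single_0] by simp_all
  thus "card (span (insert v {0}) - {0}) = CARD('a) - 1" "finite (span (insert v {0}))"
    using span_zero by (simp_all add: card_Diff_singleton)
qed

lemma point_subset_scale_closed:
  assumes "\<And>c x. c \<noteq> 0 \<Longrightarrow> x \<in> B \<Longrightarrow> c *s x \<in> B" "v \<in> B"
  shows "span (insert v {0}) - {0} \<subseteq> B"
proof
  fix x assume x: "x \<in> span (insert v {0}) - {0}"
  then obtain k where "x = k *s v"
    using span_insert_subspace[OF subspace_single_0, of v] by auto
  thus "x \<in> B" using x assms by auto
qed

text \<open>Such a set is a disjoint union of punctured lines, each with q - 1 vectors.\<close>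

lemma dvd_card_scale_closed:
  assumes "finite B" "0 \<notin> B" and closed: "\<And>c x. c \<noteq> 0 \<Longrightarrow> x \<in> B \<Longrightarrow> c *s x \<in> B"
  shows "CARD('a) - 1 dvd card B"
proof -
  let ?C = "\<lambda>v. span (insert v {0}) - {0}"
  have "v \<in> ?C v" if "v \<in> B" for v using that assms(2) by (auto intro: span_base)
  hence U: "\<Union> (?C ` B) = B"
    using point_subset_scale_closed[of B, OF closed] by blast
  have "?C x = ?C y" if "z \<in> ?C x" "z \<in> ?C y" for x y z
    using that span_insert_exchange[OF subspace_single_0, of z] by blast
  hence "\<forall>c1\<in>?C ` B. \<forall>c2\<in>?C ` B. c1 \<noteq> c2 \<longrightarrow> c1 \<inter> c2 = {}" by blast
  moreover have "\<forall>c\<in>?C ` B. CARD('a) - 1 dvd card c"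
  proof
    fix c assume "c \<in> ?C ` B"
    then obtain v where "v \<in> B" "c = ?C v" by blast
    moreover have "v \<noteq> 0" using \<open>v \<in> B\<close> assms(2) by blast
    ultimately show "CARD('a) - 1 dvd card c" using card_point(1)[of v] by simp
  qed
  ultimately have "CARD('a) - 1 dvd card (\<Union> (?C ` B))"
    using assms(1) U by (intro dvd_partition) auto
  thus ?thesis unfolding U .
qed

text \<open>Greedy averaging: start from \<open>{0}\<close> and repeatedly adjoin a vector whose
  class gains at most the average number of vectors of \<open>B\<close>. The density of
  \<open>B\<close> among nonzero vectors then never exceeds its density in \<open>V\<close>.\<close>

lemma ex_subspace_low_density:
  assumes "subspace V" "finite V" "B \<subseteq> V" "0 \<notin> B" "i \<le> dim V"
  obtains Z where "subspace Z" "Z \<subseteq> V" "dim Z = i"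
    "card (B \<inter> Z) * (CARD('a) ^ dim V - 1) \<le> card B * (CARD('a) ^ i - 1)"
proof -
  define q where "q = CARD('a)"
  have q2: "2 \<le> q" using card_field_ge_2 by (simp add: q_def)
  have finB: "finite B" using assms finite_subset by blast
  have "\<exists>Z. subspace Z \<and> Z \<subseteq> V \<and> dim Z = i \<and> card (B \<inter> Z) * (q ^ dim V - 1) \<le> card B * (q ^ i - 1)"
    using assms(5)
  proof (induction i)
    case 0
    have "B \<inter> {0} = {}" using assms(4) by blast
    thus ?case
      using subspace_0[OF assms(1)]
      by (intro exI[of _ "{0}"]) (simp add: subspace_single_0 dim_zero_subspace)
  next
    case (Suc i)
    then obtain Z where Z: "subspace Z" "Z \<subseteq> V" "dim Z = i"
      and den: "card (B \<inter> Z) * (q ^ dim V - 1) \<le> card B * (q ^ i - 1)" by auto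
    have finZ: "finite Z" using Z(2) assms(2) finite_subset by blast
    let ?C = "\<lambda>v. span (insert v Z) - Z"
    let ?A = "B - Z" and ?X = "V - Z"
    have cZ: "card Z = q ^ i" and cV: "card V = q ^ dim V"
      using card_subspace Z assms finZ by (auto simp: q_def)
    have lt: "q ^ i < q ^ dim V" and le: "q * q ^ i \<le> q ^ dim V"
      using q2 Suc.prems power_increasing[of "Suc i" "dim V" q] by simp_all
    have cX: "card ?X = q ^ dim V - q ^ i"
      using cZ cV Z finZ by (simp add: card_Diff_subset)
    have closed: "?C v \<subseteq> ?X" if "v \<in> ?X" for v
      using span_minimal[of "insert v Z" V] that Z assms(1) by blast
    have sum: "(\<Sum>v\<in>?X. card (?A \<inter> ?C v)) = card ?A * ((q - 1) * q ^ i)"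
      unfolding q_def cZ[symmetric, unfolded q_def]
      by (rule sum_card_Int_classes[OF Z(1) finZ]) (use assms closed in auto)
    have X0: "?X \<noteq> {}" using cX lt by (metis card.empty less_numeral_extra(3) zero_less_diff)
    \<comment> \<open>The sum over all \<open>v\<close> is known exactly, so some term is at most
      the mean.\<close>
    have "\<exists>v\<in>?X. card (?A \<inter> ?C v) * card ?X \<le> card ?A * ((q - 1) * q ^ i)"
    proof (rule ccontr)
      assume "\<not> ?thesis"
      hence "(\<Sum>v\<in>?X. card ?A * ((q - 1) * q ^ i)) < (\<Sum>v\<in>?X. card (?A \<inter> ?C v) * card ?X)"
        using assms(2) X0 by (intro sum_strict_mono) (auto simp: not_le)
      thus False unfolding sum_distrib_right[symmetric] sum by simp
    qed
    then obtain v where v: "v \<in> V" "v \<notin> Z"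
      and g: "card (?A \<inter> ?C v) * (q ^ dim V - q ^ i) \<le> card ?A * ((q - 1) * q ^ i)"
      using cX by auto
    let ?Y = "span (insert v Z)"
    have ZY: "Z \<subseteq> ?Y" by (auto intro: span_base)
    have cY: "card (B \<inter> ?Y) = card (B \<inter> Z) + card (?A \<inter> ?C v)"
      using finB ZY by (subst card_Un_disjoint[symmetric]) (auto intro!: arg_cong[of _ _ card])
    have cA: "card ?A = card B - card (B \<inter> Z)" using finB by (simp add: card_Diff_subset_Int)
    have cB: "card (B \<inter> Z) \<le> card B" using finB by (intro card_mono) auto
    have pr: "int (x - 1) = int x - 1" if "1 \<le> x" for x using that by simp
    have pw: "1 \<le> q ^ k" for k using q2 by simp
    have "(int (card (B \<inter> Z)) + int (card (?A \<inter> ?C v))) * (int (q ^ dim V) - 1)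
        \<le> int (card B) * (int q * int (q ^ i) - 1)"
    proof (rule greedy_density_step)
      show "int (card (B \<inter> Z)) * (int (q ^ dim V) - 1) \<le> int (card B) * (int (q ^ i) - 1)"
        using of_nat_mono[OF den, where 'a = int] unfolding of_nat_mult pr[OF pw] .
      show "int (card (?A \<inter> ?C v)) * (int (q ^ dim V) - int (q ^ i))
          \<le> (int (card B) - int (card (B \<inter> Z))) * ((int q - 1) * int (q ^ i))"
        using of_nat_mono[OF g, where 'a = int] q2
        unfolding of_nat_mult cA of_nat_diff[OF cB] of_nat_diff[OF less_imp_le[OF lt]] by simp
      show "int q * int (q ^ i) \<le> int (q ^ dim V)"
        using of_nat_mono[OF le, where 'a = int] unfolding of_nat_mult .
      show "int (q ^ i) < int (q ^ dim V)" using lt by (simp only: of_nat_less_iff)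
      show "1 \<le> int (q ^ dim V)" using of_nat_mono[OF pw, where 'a = int] by simp
    qed
    hence "int ((card (B \<inter> Z) + card (?A \<inter> ?C v)) * (q ^ dim V - 1))
        \<le> int (card B * (q ^ Suc i - 1))"
      unfolding of_nat_mult of_nat_add pr[OF pw] unfolding power_Suc of_nat_mult .
    hence "card (B \<inter> ?Y) * (q ^ dim V - 1) \<le> card B * (q ^ Suc i - 1)"
      unfolding cY by (simp only: of_nat_le_iff)
    moreover have "?Y \<subseteq> V" using v Z assms(1) by (intro span_minimal) auto
    moreover have "dim ?Y = Suc i" using dim_span_insert_subspace[OF Z(1) finZ v(2)] Z(3) by simp
    ultimately show ?case using subspace_span by blast
  qed
  thus ?thesis using that unfolding q_def by blast
qed

text \<open>Adjoining to \<open>T\<close> a vector outside \<open>H\<close> gives a subspace that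
  meets \<open>H\<close> only in \<open>T\<close> and is blocked by \<open>B\<close>, so its part
  outside \<open>H\<close> contains a punctured line of \<open>B\<close>. There are q^(dim H - dim
  T) such extensions, with disjoint parts outside \<open>H\<close>.\<close>

lemma card_outside_hyperplane:
  assumes V: "subspace V" "finite V" and H: "subspace H" "H \<subseteq> V" "dim V = Suc (dim H)"
    and T: "subspace T" "T \<subseteq> H" "T \<inter> B = {}"
    and B: "B \<subseteq> V" "0 \<notin> B" "\<And>c x. c \<noteq> 0 \<Longrightarrow> x \<in> B \<Longrightarrow> c *s x \<in> B"
    and block: "\<And>U. subspace U \<Longrightarrow> U \<subseteq> V \<Longrightarrow> dim U = Suc (dim T) \<Longrightarrow> U \<inter> B \<noteq> {}"
  shows "(CARD('a) - 1) * CARD('a) ^ (dim H - dim T) \<le> card (B - H)"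
proof -
  define q where "q = CARD('a)"
  have q2: "2 \<le> q" using card_field_ge_2 by (simp add: q_def)
  have finH: "finite H" and finT: "finite T" using V H T by (auto intro: finite_subset)
  let ?C = "\<lambda>v. span (insert v T) - T"
  let ?A = "B - H" and ?X = "V - H"
  have closed: "?C v \<subseteq> ?X" if "v \<in> ?X" for v
  proof
    fix x assume x: "x \<in> ?C v"
    have "span (insert v T) \<subseteq> V" using that V H T by (intro span_minimal) auto
    moreover have "x \<notin> H"
    proof
      assume "x \<in> H"
      hence "span (insert x T) \<subseteq> H" using T H by (intro span_minimal) auto
      thus False using that x span_insert_exchange[OF T(1), of x v] span_base[of v "insert v T"] by auto
    qed
    ultimately show "x \<in> ?X" using x by blast
  qed
  have many: "q - 1 \<le> card (?A \<inter> ?C v)" if v: "v \<in> ?X" for v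
  proof -
    have "v \<notin> T" using v T by blast
    hence "dim (span (insert v T)) = Suc (dim T)" using dim_span_insert_subspace T(1) finT by blast
    moreover have "span (insert v T) \<subseteq> V" using v V H T by (intro span_minimal) auto
    ultimately obtain b where b: "b \<in> span (insert v T)" "b \<in> B" using block[OF subspace_span] by blast
    hence bT: "b \<notin> T" using T by blast
    have b0: "b \<noteq> 0" using b B by auto
    let ?P = "span (insert b {0}) - {0}"
    have P: "?P \<subseteq> B" using point_subset_scale_closed[of B b] B(3) b(2) by blast
    moreover have "?P \<subseteq> span (insert v T)"
      using span_minimal[of "insert b {0}" "span (insert v T)"] b(1) span_zero by blast
    ultimately have "?P \<subseteq> ?A \<inter> ?C v"
      using closed[OF v] T(3) by blast
    moreover have "finite (?A \<inter> ?C v)" using B V by (meson finite_Diff finite_Int finite_subset)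
    ultimately show ?thesis using card_mono card_point(1)[OF b0] by (metis q_def)
  qed
  have cX: "card ?X = (q - 1) * q ^ dim H"
    using V H finH card_subspace[OF V] card_subspace[OF H(1) finH]
    by (simp add: card_Diff_subset q_def diff_mult_distrib)
  have "card ?X * (q - 1) = (\<Sum>v\<in>?X. q - 1)" by simp
  also have "\<dots> \<le> (\<Sum>v\<in>?X. card (?A \<inter> ?C v))" using many by (intro sum_mono) auto
  also have "\<dots> = card ?A * ((q - 1) * card T)"
    unfolding q_def by (rule sum_card_Int_classes[OF T(1) finT]) (use V H T B closed in auto)
  finally have "q ^ dim H * (q - 1) \<le> card ?A * q ^ dim T"
    using q2 cX card_subspace[OF T(1) finT] by (simp add: q_def ac_simps)
  moreover have e: "q ^ dim H = q ^ (dim H - dim T) * q ^ dim T"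
    using dim_subspace_mono[OF T(1) H(1) finH T(2)] by (simp add: power_add[symmetric])
  have "((q - 1) * q ^ (dim H - dim T)) * q ^ dim T = q ^ dim H * (q - 1)"
    unfolding e by (simp only: ac_simps)
  ultimately have "((q - 1) * q ^ (dim H - dim T)) * q ^ dim T \<le> card ?A * q ^ dim T"
    by (simp only:)
  thus ?thesis using q2 by (simp add: q_def)
qed

text \<open>Through a subspace of codimension 2 pass q + 1 hyperplanes, and a vector outside it lies
  off exactly q of them. Summing the lower bound \<open>K\<close> over the pencil counts every
  vector of \<open>B - Z\<close> q times.\<close>

lemma card_outside_pencil:
  assumes V: "subspace V" "finite V" and Z: "subspace Z" "Z \<subseteq> V" "dim V = Suc (Suc (dim Z))"
    and B: "B \<subseteq> V"
    and many: "\<And>H. subspace H \<Longrightarrow> Z \<subseteq> H \<Longrightarrow> H \<subseteq> V \<Longrightarrow> dim H = Suc (dim Z) \<Longrightarrow> K \<le> card (B - H)"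
  shows "(CARD('a) + 1) * K \<le> CARD('a) * card (B - Z)"
proof -
  define q where "q = CARD('a)"
  have q2: "2 \<le> q" using card_field_ge_2 by (simp add: q_def)
  have finZ: "finite Z" and finB: "finite B" using V Z B by (auto intro: finite_subset)
  let ?C = "\<lambda>v. span (insert v Z) - Z"
  let ?A = "B - Z" and ?X = "V - Z"
  have sub: "span (insert v Z) \<subseteq> V" if "v \<in> ?X" for v
    using that V Z by (intro span_minimal) auto
  have K: "card (?A \<inter> ?C v) + K \<le> card ?A" if v: "v \<in> ?X" for v
  proof -
    have "Z \<subseteq> span (insert v Z)" by (auto intro: span_base)
    moreover have "dim (span (insert v Z)) = Suc (dim Z)"
      using dim_span_insert_subspace[OF Z(1) finZ] v by blast
    ultimately have "K \<le> card (B - span (insert v Z))" using many sub[OF v] subspace_span by blast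
    moreover have "card ?A = card (?A \<inter> ?C v) + card (B - span (insert v Z))"
      using finB \<open>Z \<subseteq> span (insert v Z)\<close>
      by (subst card_Un_disjoint[symmetric]) (auto intro!: arg_cong[of _ _ card])
    ultimately show ?thesis by simp
  qed
  have cX: "card ?X = q ^ dim Z * ((q + 1) * (q - 1))"
    using V Z finZ card_subspace[OF V] card_subspace[OF Z(1) finZ]
    by (simp add: card_Diff_subset q_def algebra_simps)
  have "card ?A * ((q - 1) * card Z) + card ?X * K = (\<Sum>v\<in>?X. card (?A \<inter> ?C v)) + card ?X * K"
    unfolding q_def by (subst sum_card_Int_classes[OF Z(1) finZ]) (use V Z B sub in auto)
  also have "\<dots> = (\<Sum>v\<in>?X. card (?A \<inter> ?C v) + K)" by (simp add: sum.distrib)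
  also have "\<dots> \<le> (\<Sum>v\<in>?X. card ?A)" using K by (intro sum_mono) auto
  also have "\<dots> = card ?X * card ?A" by simp
  finally have "((q - 1) * q ^ dim Z) * (card ?A + (q + 1) * K) \<le> ((q - 1) * q ^ dim Z) * ((q + 1) * card ?A)"
    unfolding cX card_subspace[OF Z(1) finZ] q_def[symmetric] by (simp add: algebra_simps)
  hence "card ?A + (q + 1) * K \<le> (q + 1) * card ?A" using q2 by simp
  thus ?thesis by (simp add: q_def)
qed

text \<open>Induction on \<open>n + t\<close>: a hyperplane with few points of \<open>B\<close> yields an \<open>(n - 1)\<close>-dimensional \<open>W\<close>
  inside \<open>B\<close>. Either \<open>B\<close> blocks the \<open>(t - 1)\<close>-dimensional subspaces of some hyperplane through \<open>W\<close>
  and induction applies there, or many points of \<open>B\<close> lie outside every such hyperplane, and a pencil of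
  hyperplanes through \<open>W\<close> gives too many points. The size bound for \<open>B\<close> is exactly what this last
  count contradicts.\<close>

theorem blocking_set_contains_subspace:
  assumes "subspace V" "finite V" "dim V + 1 = n + t" "1 \<le> n" "1 \<le> t"
    and "B \<subseteq> V" "0 \<notin> B" "\<And>c x. c \<noteq> 0 \<Longrightarrow> x \<in> B \<Longrightarrow> c *s x \<in> B"
    and "\<And>U. subspace U \<Longrightarrow> U \<subseteq> V \<Longrightarrow> dim U = t \<Longrightarrow> U \<inter> B \<noteq> {}"
    and "CARD('a) * card B + CARD('a) + CARD('a) ^ (n - 1) < CARD('a) ^ (n + 1) + CARD('a) ^ n"
  shows "\<exists>N. subspace N \<and> N \<subseteq> V \<and> dim N = n \<and> N - {0} \<subseteq> B"
  using assms
proof (induction "n + t" arbitrary: n t V B rule: less_induct)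
  case less
  note V = less.prems(1,2) and dimV = less.prems(3) and B = less.prems(6,7,8)
    and block = less.prems(9) and small = less.prems(10)
  define q where "q = CARD('a)"
  have q2: "2 \<le> q" using card_field_ge_2 by (simp add: q_def)
  have finB: "finite B" using V B(1) finite_subset by blast
  have point: "subspace (span (insert v {0}))" "dim (span (insert v {0})) = 1" if "v \<noteq> 0" for v
    using that dim_span_insert_subspace[OF subspace_single_0, of v]
    by (simp_all add: dim_zero_subspace subspace_single_0)
  \<comment> \<open>For \<open>t = 1\<close> all lines are blocked, so \<open>B\<close> is
    \<open>V - {0}\<close> and \<open>dim V = n\<close>. For \<open>n = 1\<close> the space
    \<open>V\<close> itself has dimension \<open>t\<close>, so \<open>B\<close> is nonempty and
    contains a punctured line.\<close>
  consider "t = 1" | "n = 1" | "2 \<le> n" "2 \<le> t" using less.prems(4,5) by linarith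
  thus ?case
  proof cases
    case 1
    have "v \<in> B" if v: "v \<in> V - {0}" for v
    proof -
      let ?L = "span (insert v {0})"
      have "?L \<subseteq> V" using v V subspace_0[OF V(1)] by (intro span_minimal) auto
      then obtain b where b: "b \<in> ?L" "b \<in> B" using block[OF point(1)] point(2) v 1 by blast
      hence "b \<noteq> 0" using B by blast
      hence "v \<in> span (insert b {0}) - {0}"
        using span_insert_exchange[OF subspace_single_0 b(1)] v by (simp add: span_base)
      thus "v \<in> B" using point_subset_scale_closed[of B b] B(3) b(2) by blast
    qed
    thus ?thesis using V dimV 1 by (intro exI[of _ V]) auto
  next
    case 2
    hence "V \<inter> B \<noteq> {}" using block[OF V(1)] dimV by simp
    then obtain b where b: "b \<in> B" "b \<noteq> 0" using B by blast
    moreover have "span (insert b {0}) \<subseteq> V"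
      using b B V subspace_0[OF V(1)] by (intro span_minimal) auto
    ultimately show ?thesis
      using point_subset_scale_closed[of B b] B(3) point[of b] 2 by blast
  next
    case 3
    then obtain k where k: "n = Suc (Suc k)" using le_Suc_ex[of 2 n] by auto
    have nt: "dim V = Suc (Suc (n + t - 3))" using dimV 3 by simp
    obtain H where H: "subspace H" "H \<subseteq> V" "dim H = Suc (n + t - 3)"
      and den: "card (B \<inter> H) * (q ^ dim V - 1) \<le> card B * (q ^ dim H - 1)"
      using ex_subspace_low_density[OF V B(1,2), of "Suc (n + t - 3)"] nt unfolding q_def by auto
    obtain U where U: "subspace U" "U \<subseteq> V" "dim U = t"
      using subspace_between[OF subspace_single_0 V, of t] subspace_0[OF V(1)] dimV less.prems(4)
      by (auto simp: dim_zero_subspace subspace_single_0)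
    hence posB: "0 < card B" using block[OF U] finB by (auto simp: card_gt_0_iff)
    \<comment> \<open>With d = \<open>dim V\<close>, the density bound leaves at most the fraction
      (q^(d-1) - 1) / (q^d - 1) < 1 / q of \<open>B\<close> in \<open>H\<close>; strictness uses
      that \<open>B\<close> is nonempty.\<close>
    have "q * card (B \<inter> H) < card B"
    proof (rule ccontr)
      assume "\<not> ?thesis"
      hence "card B * (q ^ dim V - 1) \<le> q * (card (B \<inter> H) * (q ^ dim V - 1))" by simp
      also have "\<dots> \<le> q * (card B * (q ^ dim H - 1))" using den by simp
      finally have "q ^ dim V - 1 \<le> q * (q ^ dim H - 1)" using posB by simp
      hence "q * q ^ dim H - 1 \<le> q * q ^ dim H - q"
        using nt H(3) by (simp add: diff_mult_distrib2)
      moreover have "q * 1 \<le> q * q ^ dim H" using q2 by (intro mult_left_mono) auto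
      ultimately show False using q2 by linarith
    qed
    \<comment> \<open>Both cardinalities are multiples of q - 1, so their positive difference
      \<open>card B - q * card (B \<inter> H)\<close> is at least q - 1. This rounding makes the
      size bound for \<open>n\<close> imply the one for \<open>n - 1\<close> in
      \<open>H\<close>.\<close>
    moreover have dvd: "q - 1 dvd card B" "q - 1 dvd card (B \<inter> H)"
      unfolding q_def using finB B subspace_scale[OF H(1)]
      by (intro dvd_card_scale_closed; auto)+
    ultimately have "q - 1 \<le> card B - q * card (B \<inter> H)"
      by (intro dvd_imp_le dvd_diff_nat dvd_mult) auto
    hence "q * card (B \<inter> H) + q \<le> card B + 1"
      using \<open>q * card (B \<inter> H) < card B\<close> q2 by linarith
    moreover have "card B + 1 + q ^ (n - 2) < q ^ n + q ^ (n - 1)"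
    proof -
      have "q ^ (n - 1) = q * q ^ (n - 2)" "q ^ n = q * q ^ (n - 1)"
        by (simp_all add: k)
      hence "q * (card B + 1 + q ^ (n - 2)) < q * (q ^ n + q ^ (n - 1))"
        using small unfolding q_def[symmetric] by (simp add: algebra_simps)
      thus ?thesis by (rule mult_less_cancel1[THEN iffD1, THEN conjunct2])
    qed
    ultimately have smallH: "q * card (B \<inter> H) + q + q ^ (n - 1 - 1) < q ^ (n - 1 + 1) + q ^ (n - 1)"
      by (simp add: k)
    have "\<exists>W. subspace W \<and> W \<subseteq> H \<and> dim W = n - 1 \<and> W - {0} \<subseteq> B \<inter> H"
    proof (rule less.hyps[of "n - 1" t])
      show "finite H" using H V finite_subset by blast
      show "U \<inter> (B \<inter> H) \<noteq> {}" if "subspace U" "U \<subseteq> H" "dim U = t" for U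
        using block[of U] that H(2) by blast
      show "CARD('a) * card (B \<inter> H) + CARD('a) + CARD('a) ^ (n - 1 - 1) < CARD('a) ^ (n - 1 + 1) + CARD('a) ^ (n - 1)"
        using smallH unfolding q_def .
    qed (use 3 H B in \<open>auto simp: subspace_scale\<close>)
    then obtain W where W: "subspace W" "W \<subseteq> V" "dim W = n - 1" "W - {0} \<subseteq> B"
      using H(2) by blast
    \<comment> \<open>\<open>Z\<close> has codimension 2, so the hyperplanes through it form a
      pencil; it contains \<open>W\<close>, so the nonzero vectors of \<open>W\<close> come on top
      of those of \<open>B - Z\<close>.\<close>
    have "dim W \<le> n + t - 3" "n + t - 3 \<le> dim V" using W(3) nt 3 by simp_all
    then obtain Z where Z: "subspace Z" "W \<subseteq> Z" "Z \<subseteq> V" "dim Z = n + t - 3"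
      by (rule subspace_between[OF W(1) V W(2)])
    show ?thesis
    proof (cases "\<exists>H. subspace H \<and> Z \<subseteq> H \<and> H \<subseteq> V \<and> dim H = Suc (dim Z) \<and>
        (\<forall>U. subspace U \<longrightarrow> U \<subseteq> H \<longrightarrow> dim U = t - 1 \<longrightarrow> U \<inter> B \<noteq> {})")
      case True
      then obtain H where H: "subspace H" "H \<subseteq> V" "dim H = Suc (n + t - 3)"
        and blockH: "\<And>U. subspace U \<Longrightarrow> U \<subseteq> H \<Longrightarrow> dim U = t - 1 \<Longrightarrow> U \<inter> B \<noteq> {}"
        using Z(4) by auto
      have "\<exists>N. subspace N \<and> N \<subseteq> H \<and> dim N = n \<and> N - {0} \<subseteq> B \<inter> H"
      proof (rule less.hyps[of n "t - 1"])
        show "finite H" using H V finite_subset by blast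
        show "U \<inter> (B \<inter> H) \<noteq> {}" if "subspace U" "U \<subseteq> H" "dim U = t - 1" for U
          using blockH[of U] that by blast
        have "CARD('a) * card (B \<inter> H) \<le> CARD('a) * card B" using finB by (auto intro: card_mono)
        thus "CARD('a) * card (B \<inter> H) + CARD('a) + CARD('a) ^ (n - 1) < CARD('a) ^ (n + 1) + CARD('a) ^ n"
          using small by linarith
      qed (use 3 H B in \<open>auto simp: subspace_scale\<close>)
      thus ?thesis using H(2) by blast
    next
      case False
      \<comment> \<open>Every hyperplane \<open>H\<close> through \<open>Z\<close> now has a
        subspace \<open>T\<close> of dimension \<open>t - 1\<close> that misses \<open>B\<close>;
        the exponent is (n + t - 2) - (t - 1) = n - 1.\<close>
      have "(q - 1) * q ^ (n - 1) \<le> card (B - H)"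
        if H: "subspace H" "Z \<subseteq> H" "H \<subseteq> V" "dim H = Suc (dim Z)" for H
      proof -
        obtain T where T: "subspace T" "T \<subseteq> H" "dim T = t - 1" "T \<inter> B = {}"
          using False H by blast
        have "(q - 1) * q ^ (dim H - dim T) \<le> card (B - H)"
          unfolding q_def
        proof (rule card_outside_hyperplane[OF V H(1,3) _ T(1,2,4) B])
          show "U \<inter> B \<noteq> {}" if "subspace U" "U \<subseteq> V" "dim U = Suc (dim T)" for U
            using block[OF that(1,2)] that(3) T(3) 3 by simp
        qed (use nt Z(4) H(4) in auto)
        moreover have "dim H - dim T = n - 1" using H(4) Z(4) T(3) 3 by simp
        ultimately show ?thesis by simp
      qed
      hence "(q + 1) * ((q - 1) * q ^ (n - 1)) \<le> q * card (B - Z)"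
        unfolding q_def by (intro card_outside_pencil[OF V Z(1,3) _ B(1)]) (use nt Z(4) in auto)
      moreover have "card (B - Z) + (q ^ (n - 1) - 1) \<le> card B"
      proof -
        have finW: "finite W" using W(2) V finite_subset by blast
        have "card (W - {0}) = q ^ (n - 1) - 1"
          using card_subspace[OF W(1) finW] W(3) subspace_0[OF W(1)] by (simp add: q_def)
        moreover have "card ((B - Z) \<union> (W - {0})) = card (B - Z) + card (W - {0})"
          using finB finW Z(2) by (intro card_Un_disjoint) auto
        moreover have "card ((B - Z) \<union> (W - {0})) \<le> card B"
          using W(4) finB by (intro card_mono) auto
        ultimately show ?thesis by simp
      qed
      ultimately have "q * q * q ^ (n - 1) + q * q ^ (n - 1) \<le> q * card B + q + q ^ (n - 1)"
        using q2 by (intro pencil_bound_arith) simp_all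
      thus ?thesis using small[folded q_def] by (simp add: k)
    qed
  qed
qed

section \<open>Enlarging disjoint subspaces\<close>

text \<open>Pigeonhole: addition from \<open>S \<times> T\<close> to \<open>E\<close> cannot be
  injective, and a collision yields a nonzero difference in both subspaces.\<close>

lemma subspace_Int_nontrivial:
  assumes "subspace S" "subspace T" "subspace E" "finite E" "S \<subseteq> E" "T \<subseteq> E"
    and "dim E < dim S + dim T"
  obtains v where "v \<in> S" "v \<in> T" "v \<noteq> 0"
proof -
  have fin: "finite S" "finite T" using assms by (auto intro: finite_subset)
  have "card (S \<times> T) = CARD('a) ^ (dim S + dim T)"
    using card_subspace assms(1,2) fin by (simp add: card_cartesian_product power_add)
  also have "\<dots> > card E"
    using card_subspace[OF assms(3,4)] card_field_ge_2 assms(7)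
    by (simp add: power_strict_increasing)
  finally have "\<not> inj_on (\<lambda>(x, y). x + y) (S \<times> T)"
    using card_inj_on_le[of "\<lambda>(x, y). x + y" "S \<times> T" E] assms subspace_add by fastforce
  then obtain x y x' y' where xy: "x \<in> S" "y \<in> T" "x' \<in> S" "y' \<in> T" "x + y = x' + y'" "(x, y) \<noteq> (x', y')"
    by (auto simp: inj_on_def)
  have "x - x' = y' - y" using xy(5) by (simp add: algebra_simps)
  moreover have "x - x' \<in> S" "y' - y \<in> T" using xy assms subspace_diff by blast+
  moreover have "x - x' \<noteq> 0" using xy(5,6) by auto
  ultimately show ?thesis using that[of "x - x'"] by simp
qed

text \<open>A basis of \<open>T\<close> through the common vector \<open>w\<close> may drop
  \<open>w\<close>, whose multiples are absorbed by \<open>S\<close>; this saves a factor q.\<close>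

lemma card_set_plus_le_overlap:
  assumes "subspace S" "finite S" "subspace T" "finite T" "w \<in> S" "w \<in> T" "w \<noteq> 0"
  shows "card (S + T) \<le> CARD('a) ^ (dim S + dim T - 1)"
proof -
  have "independent {w}" using assms by simp
  then obtain B where B: "{w} \<subseteq> B" "B \<subseteq> T" "independent B" "T \<subseteq> span B"
    using maximal_independent_subset_extend[of "{w}" T] assms(6) by blast
  have "finite B" using B(2) assms(4) finite_subset by blast
  have ind: "independent (B - {w})" using B(3) independent_mono by blast
  have "card B = dim T" using B basis_card_eq_dim by blast
  hence cB: "card (B - {w}) = dim T - 1" using B(1) \<open>finite B\<close> by simp
  let ?D = "span (B - {w})"
  have D: "finite ?D" "card ?D = CARD('a) ^ (dim T - 1)"
    using card_span_independent[OF _ ind] \<open>finite B\<close> cB by auto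
  have "S + T \<subseteq> S + ?D"
  proof
    fix z assume "z \<in> S + T"
    then obtain x y where z: "z = x + y" "x \<in> S" "y \<in> T" by (rule set_plus_elim)
    have "insert w (B - {w}) = B" using B(1) by blast
    hence "y \<in> span (insert w (B - {w}))" using B(4) z(3) by auto
    then obtain k where k: "y - k *s w \<in> ?D" unfolding span_breakdown_eq by blast
    have "z = (x + k *s w) + (y - k *s w)" using z(1) by simp
    moreover have "x + k *s w \<in> S" using z(2) assms(1,5) subspace_add subspace_scale by blast
    ultimately show "z \<in> S + ?D" using k set_plus_intro by metis
  qed
  moreover have "finite (S + ?D)"
    using assms(2) D(1) by (rule finite_set_plus)
  ultimately have "card (S + T) \<le> card (S + ?D)"
    by (intro card_mono)
  also have "\<dots> \<le> card S * card ?D" using assms(2) D(1) by (rule card_set_plus_le)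
  also have "\<dots> = CARD('a) ^ (dim S + (dim T - 1))"
    using card_subspace[OF assms(1,2)] D(2) by (simp add: power_add)
  also have "dim S + (dim T - 1) = dim S + dim T - 1"
  proof -
    have "B \<noteq> {}" using B(1) by blast
    thus ?thesis using \<open>card B = dim T\<close> \<open>finite B\<close> by (metis Nat.add_diff_assoc One_nat_def Suc_leI card_gt_0_iff)
  qed
  finally show ?thesis .
qed

lemma subspace_set_plus:
  assumes "subspace S" "subspace T"
  shows "subspace (S + T)"
proof -
  have "S + T = {x + y |x y. x \<in> S \<and> y \<in> T}" by (auto simp: set_plus_def)
  thus ?thesis using subspace_sums[OF assms] by simp
qed

text \<open>Read contrapositively: if \<open>v\<close> lies outside \<open>S + T\<close>, adjoining
  \<open>v\<close> to \<open>T\<close> creates no new intersection with \<open>S\<close>.\<close>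

lemma in_set_plus_if_scale:
  assumes "subspace S" "subspace T" "k \<noteq> 0" "k *s v + y \<in> S" "y \<in> T"
  shows "v \<in> S + T"
proof -
  let ?Z = "S + T"
  have "k *s v = (k *s v + y) + (- y)" by simp
  moreover have "- y \<in> T" using assms(2,5) subspace_neg by blast
  ultimately have "k *s v \<in> ?Z" using set_plus_intro[OF assms(4)] by metis
  hence "inverse k *s (k *s v) \<in> ?Z"
    using subspace_scale[OF subspace_set_plus[OF assms(1,2)]] by blast
  thus ?thesis using assms(3) by simp
qed

text \<open>The extensions are built one vector at a time. A vector is unsuitable for enlarging \<open>f W\<close> if
  it lies in \<open>V + f W\<close> or in \<open>f U + f W\<close> for another small \<open>U\<close>; members of dimension \<open>t\<close> stay
  inside \<open>V\<close> and impose no condition of their own.\<close>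

lemma extend_disjoint_subspaces:
  assumes E: "subspace E" "finite E" "dim E + 1 = dim V + t" and V: "subspace V" "V \<subseteq> E"
    and t: "1 \<le> t" "t + 1 \<le> dim V"
    and P: "finite P" "\<And>W. W \<in> P \<Longrightarrow> subspace W \<and> W \<subseteq> V \<and> W \<noteq> {0} \<and> dim W \<le> t"
    and disj: "\<And>U W. U \<in> P \<Longrightarrow> W \<in> P \<Longrightarrow> U \<noteq> W \<Longrightarrow> U \<inter> W = {0}"
    and few: "card {W\<in>P. dim W < t} \<le> CARD('a) ^ (dim V - t - 1)"
  shows "\<exists>f. \<forall>W\<in>P. subspace (f W) \<and> f W \<subseteq> E \<and> f W \<inter> V = W \<and> dim (f W) = t \<and>
    (\<forall>U\<in>P. U \<noteq> W \<longrightarrow> f U \<inter> f W = {0})"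
proof -
  define q where "q = CARD('a)"
  have q2: "2 \<le> q" using card_field_ge_2 by (simp add: q_def)
  \<comment> \<open>The invariant of the construction: all requirements on the final
    \<open>f\<close>, with \<open>t\<close> only an upper bound for the dimensions.\<close>
  define good where "good f \<longleftrightarrow> (\<forall>W\<in>P. subspace (f W) \<and> f W \<subseteq> E \<and> f W \<inter> V = W \<and> dim (f W) \<le> t \<and>
    (\<forall>U\<in>P. U \<noteq> W \<longrightarrow> f U \<inter> f W = {0}))" for f
  have finV: "finite V" using V E finite_subset by blast
  \<comment> \<open>The unsuitable vectors number fewer than 2 q^(dim V + t - 2), which is at most
    q^(dim V + t - 1), the size of \<open>E\<close>.\<close>
  have step: "\<exists>v\<in>E. v \<notin> V + f W \<and>
      (\<forall>U\<in>P. dim U < t \<longrightarrow> U \<noteq> W \<longrightarrow> v \<notin> f U + f W)"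
    if f: "good f" and W: "W \<in> P" "dim (f W) < t" for f W
  proof -
    define Sm where "Sm = {U\<in>P. dim U < t}"
    have fU: "subspace (f U)" "f U \<subseteq> E" "finite (f U)" "f U \<inter> V = U" "dim (f U) \<le> t" if "U \<in> P" for U
      using f that finite_subset[OF _ E(2)] by (simp_all add: good_def)
    have "W \<subseteq> f W" using fU(4)[OF W(1)] by blast
    hence "dim W < t"
      using dim_subspace_mono[of W "f W"] P(2)[OF W(1)] fU[OF W(1)] W(2) by simp
    hence "W \<in> Sm" using W by (simp add: Sm_def)
    \<comment> \<open>\<open>W\<close> is itself small, so it uses up one of the allowed small
      members; this is the source of the strict inequality.\<close>
    hence cSm: "card (Sm - {W}) + 1 \<le> q ^ (dim V - t - 1)"
      using few P(1) card_Suc_Diff1[of Sm W] unfolding q_def Sm_def[symmetric]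
      by (simp add: Sm_def)
    obtain w where w: "w \<in> W" "w \<noteq> 0"
      using P(2)[OF W(1)] subspace_0 by blast
    \<comment> \<open>\<open>V\<close> and \<open>f W\<close> share a nonzero vector of
      \<open>W\<close>, which saves one factor q; \<open>dim (f W) < t\<close> saves the
      second.\<close>
    have "card (V + f W) \<le> q ^ (dim V + dim (f W) - 1)"
      unfolding q_def using w \<open>W \<subseteq> f W\<close> P(2)[OF W(1)] V finV fU[OF W(1)]
      by (intro card_set_plus_le_overlap[of _ _ w]) auto
    also have "\<dots> \<le> q ^ (dim V + t - 2)" using q2 W(2) by (intro power_increasing) auto
    finally have c1: "card (V + f W) \<le> q ^ (dim V + t - 2)" .
    have c2: "card (f U + f W) \<le> q ^ (2 * t - 1)" if "U \<in> P" for U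
    proof -
      have "card (f U + f W) \<le> card (f U) * card (f W)"
        using fU(3) that W(1) by (intro card_set_plus_le)
      also have "\<dots> = q ^ (dim (f U) + dim (f W))"
        using card_subspace fU(1,3) that W(1) by (simp add: q_def power_add)
      also have "\<dots> \<le> q ^ (2 * t - 1)"
        using q2 W(2) fU(5)[OF that] by (intro power_increasing) auto
      finally show ?thesis .
    qed
    let ?bad = "(V + f W) \<union> (\<Union>U\<in>Sm - {W}. f U + f W)"
    have finSm: "finite (Sm - {W})" using P(1) by (simp add: Sm_def)
    have "card ?bad \<le> card (V + f W) + card (\<Union>U\<in>Sm - {W}. f U + f W)"
      by (rule card_Un_le)
    also have "card (\<Union>U\<in>Sm - {W}. f U + f W) \<le> (\<Sum>U\<in>Sm - {W}. card (f U + f W))"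
      by (rule card_UN_le[OF finSm])
    also have "\<dots> \<le> (\<Sum>U\<in>Sm - {W}. q ^ (2 * t - 1))"
      using c2 by (intro sum_mono) (auto simp: Sm_def)
    also have "\<dots> = card (Sm - {W}) * q ^ (2 * t - 1)" by simp
    also have "\<dots> < (card (Sm - {W}) + 1) * q ^ (2 * t - 1)" using q2 by simp
    also have "\<dots> \<le> q ^ (dim V - t - 1) * q ^ (2 * t - 1)"
      using cSm by (intro mult_right_mono) auto
    also have "\<dots> = q ^ (dim V + t - 2)"
      using t by (simp only: power_add[symmetric]) (rule arg_cong[of _ _ "power q"], linarith)
    also note c1
    finally have "card ?bad < 2 * q ^ (dim V + t - 2)" by simp
    also have "\<dots> \<le> q * q ^ (dim V + t - 2)" using q2 by simp
    also have "\<dots> = q ^ dim E"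
      unfolding power_Suc[symmetric] using t E(3) by (intro arg_cong[of _ _ "power q"]) linarith
    also have "\<dots> = card E" using card_subspace[OF E(1,2)] by (simp add: q_def)
    finally have less: "card ?bad < card E" .
    have "finite (f U + f W)" if "U \<in> Sm - {W}" for U
      using that fU(3) W(1) by (intro finite_set_plus) (auto simp: Sm_def)
    moreover have "finite (V + f W)" using finV fU(3)[OF W(1)] by (intro finite_set_plus) auto
    ultimately have "finite ?bad" using finSm by blast
    hence "\<not> E \<subseteq> ?bad" using card_mono[of ?bad E] less by linarith
    then obtain v where v: "v \<in> E" "v \<notin> ?bad" by (meson subsetI)
    have "v \<notin> V + f W" using v(2) by (rule contrapos_nn) (rule UnI1)
    moreover have "v \<notin> f U + f W" if "U \<in> P" "dim U < t" "U \<noteq> W" for U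
      using v(2)
    proof (rule contrapos_nn)
      have "U \<in> Sm - {W}" using that by (simp add: Sm_def)
      moreover assume "v \<in> f U + f W"
      ultimately show "v \<in> ?bad" by (intro UnI2 UN_I[of U])
    qed
    ultimately show ?thesis using v(1) by (intro bexI[of _ v] conjI ballI impI)
  qed
  have "\<exists>g. good g \<and> (\<forall>W\<in>P. dim (g W) = t)" if "good f" for f
    using that
  \<comment> \<open>The measure is the total number of dimensions still missing.\<close>
  proof (induction "\<Sum>W\<in>P. t - dim (f W)" arbitrary: f rule: less_induct)
    case less
    note f = less.prems
    show ?case
    proof (cases "\<forall>W\<in>P. dim (f W) = t")
      case False
      then obtain W where W: "W \<in> P" "dim (f W) < t" using f by (force simp: good_def le_less)
      obtain v where v: "v \<in> E" "v \<notin> V + f W"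
        and vU: "\<And>U. U \<in> P \<Longrightarrow> dim U < t \<Longrightarrow> U \<noteq> W \<Longrightarrow> v \<notin> f U + f W"
        using step[OF f W] by blast
      define g where "g = f(W := span (insert v (f W)))"
      have fW: "subspace (f W)" "f W \<subseteq> E" "f W \<inter> V = W" using f W by (auto simp: good_def)
      have finW: "finite (f W)" using fW E finite_subset by blast
      have "0 \<in> V" using V subspace_0 by blast
      hence "v \<notin> f W" using v(2) set_plus_intro[of 0 V v "f W"] by auto
      hence dg: "dim (g W) = Suc (dim (f W))"
        using dim_span_insert_subspace[OF fW(1) finW] by (simp add: g_def)
      have gW: "\<exists>k y. x = k *s v + y \<and> y \<in> f W" if "x \<in> g W" for x
        using that unfolding g_def fun_upd_same span_insert_subspace[OF fW(1)] by auto
      have ext: "f W \<subseteq> g W" by (auto simp: g_def intro: span_base)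
      \<comment> \<open>A vector of \<open>V\<close> in the enlarged space with nonzero coefficient
        of \<open>v\<close> would put \<open>v\<close> into \<open>V + f W\<close>.\<close>
      have inV: "x \<in> f W" if x: "x \<in> g W" "x \<in> V" for x
      proof -
        obtain k y where ky: "x = k *s v + y" "y \<in> f W" using gW[OF x(1)] by blast
        hence "k = 0" using in_set_plus_if_scale[OF V(1) fW(1), of k v y] x(2) v(2) by blast
        thus ?thesis using ky by simp
      qed
      have Int: "f U \<inter> g W = {0}" if U: "U \<in> P" "U \<noteq> W" for U
      proof -
        have fU: "subspace (f U)" "f U \<subseteq> E" "f U \<inter> V = U" "dim (f U) \<le> t" "f U \<inter> f W = {0}"
          using f U W by (auto simp: good_def)
        have "x \<in> f W" if x: "x \<in> f U" "x \<in> g W" for x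
        proof (cases "dim U < t")
          case True
          obtain k y where ky: "x = k *s v + y" "y \<in> f W" using gW[OF x(2)] by blast
          hence "k = 0"
            using in_set_plus_if_scale[OF fU(1) fW(1), of k v y] x(1) vU[OF U(1) True U(2)] by blast
          thus ?thesis using ky by simp
        next
          case False
          have "finite (f U)" using fU(2) E(2) finite_subset by blast
          \<comment> \<open>A member of full dimension \<open>t\<close> is still inside
            \<open>V\<close>, so a vector common to it and \<open>g W\<close> lies in
            \<open>V\<close> and \<open>inV\<close> applies.\<close>
          hence "U = f U"
            using False P(2)[OF U(1)] fU by (intro subspace_eqI_dim) auto
          thus ?thesis using inV[OF x(2)] x(1) P(2)[OF U(1)] by blast
        qed
        hence "f U \<inter> g W \<subseteq> {0}" using fU(5) by blast
        moreover have "0 \<in> f U" "0 \<in> g W"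
          using fU(1) fW(1) ext subspace_0 by blast+
        ultimately show ?thesis by blast
      qed
      have other: "g U = f U" if "U \<noteq> W" for U using that by (simp add: g_def)
      have "good g"
        unfolding good_def
      proof (intro ballI conjI impI)
        fix U assume U: "U \<in> P"
        show "subspace (g U)" using f U by (auto simp: g_def good_def)
        have "span (insert v (f W)) \<subseteq> E" using v(1) fW(2) E(1) by (intro span_minimal) auto
        thus "g U \<subseteq> E" using f U by (auto simp: g_def good_def)
        show "g U \<inter> V = U"
        proof (cases "U = W")
          case True
          thus ?thesis using inV ext fW(3) by blast
        qed (use f U other in \<open>auto simp: good_def\<close>)
        show "dim (g U) \<le> t"
          using dg W f U by (cases "U = W") (auto simp: other good_def)
        fix U' assume U': "U' \<in> P" "U' \<noteq> U"
        show "g U' \<inter> g U = {0}"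
        proof (cases "U = W")
          case True
          thus ?thesis using Int[of U'] U' other[of U'] by simp
        next
          case False
          show ?thesis
          proof (cases "U' = W")
            case True
            thus ?thesis using Int[OF U False] other[OF False] by (simp add: Int_commute)
          next
            case F: False
            show ?thesis using f U U' unfolding other[OF F] other[OF False] good_def by blast
          qed
        qed
      qed
      moreover have "(\<Sum>U\<in>P. t - dim (g U)) < (\<Sum>U\<in>P. t - dim (f U))"
      proof (rule sum_strict_mono_ex1[OF P(1)])
        show "\<forall>U\<in>P. t - dim (g U) \<le> t - dim (f U)"
          using dg other by (metis diff_le_mono2 le_SucI order.refl)
        show "\<exists>U\<in>P. t - dim (g U) < t - dim (f U)"
          using dg W by (intro bexI[of _ W]) auto
      qed
      ultimately show ?thesis using less.hyps by blast
    qed (use f in blast)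
  qed
  moreover have "good (\<lambda>W. W)"
    unfolding good_def
  proof (intro ballI conjI impI)
    fix W assume "W \<in> P"
    thus "subspace W" "W \<subseteq> E" "W \<inter> V = W" "dim W \<le> t" using P(2)[of W] V(2) by blast+
  qed (use disj in blast)
  ultimately obtain g where g: "good g" "\<forall>W\<in>P. dim (g W) = t" by blast
  show ?thesis by (rule exI[of _ g]) (use g in \<open>simp add: good_def\<close>)
qed

end

section \<open>Partitions from field multiplication\<close>

lemma finite_field_power_CARD:
  fixes x :: "'a::{field,finite}"
  shows "x ^ CARD('a) = x"
proof (cases "x = 0")
  case False
  \<comment> \<open>Multiplication by a nonzero \<open>x\<close> permutes the nonzero elements, so
    the product on the left is also the product of all of them.\<close>
  have "x * (\<Prod>y\<in>UNIV-{0}. x * y) = x * x ^ (CARD('a) - 1) * \<Prod>(UNIV - {0})"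
    by (simp add: prod.distrib mult_ac)
  also have "x * x ^ (CARD('a) - 1) = x ^ Suc (CARD('a) - 1)" by (subst power_Suc) auto
  also have "Suc (CARD('a) - 1) = CARD('a)" using finite_UNIV_card_ge_0[where ?'a = 'a] by simp
  also have "(\<Prod>y\<in>UNIV-{0}. x * y) = (\<Prod>y\<in>UNIV-{0}. y)"
    by (rule prod.reindex_bij_witness[of _ "\<lambda>y. y / x" "\<lambda>y. x * y"]) (use False in auto)
  finally show ?thesis by simp
qed simp

lemma CARD_eq_CHAR_power:
  assumes "primepow CARD('a::{field,finite})"
  obtains e where "CARD('a) = CHAR('a) ^ e" "prime CHAR('a)"
proof -
  \<comment> \<open>Translation by 1 permutes the field; comparing the sums shows that q vanishes in
    it, so the characteristic divides q.\<close>
  have "(\<Sum>x\<in>UNIV. x) = (\<Sum>x\<in>UNIV. x + (1 :: 'a))"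
    by (rule sum.reindex_bij_witness[of _ "\<lambda>x. x + 1" "\<lambda>x. x - 1"]) auto
  hence "of_nat CARD('a) = (0 :: 'a)" by (simp add: sum.distrib)
  hence dvd: "CHAR('a) dvd CARD('a)" by (simp add: of_nat_eq_0_iff_char_dvd)
  have prime: "prime CHAR('a)"
    using prime_CHAR_semidom[where ?'a = 'a] finite_imp_CHAR_pos[where ?'a = 'a] by simp
  obtain p k where "prime p" "CARD('a) = p ^ k" using assms by (auto simp: primepow_def)
  moreover from this have "p = CHAR('a)"
    using dvd prime prime_dvd_power primes_dvd_imp_eq by metis
  ultimately show ?thesis using that prime by blast
qed

text \<open>The polynomial X^Q - X splits, and its derivative is -1 because \<open>Q\<close>
  vanishes in the field; hence its \<open>Q\<close> roots are distinct.\<close>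

lemma card_power_fixed_points:
  assumes "of_nat Q = (0 :: 'k::alg_closed_field)" "2 \<le> Q"
  shows "card {x :: 'k. x ^ Q = x} = Q"
proof -
  define p :: "'k poly" where "p = monom 1 Q - [:0, 1:]"
  have deg: "degree p = Q"
    unfolding p_def using assms(2) by (subst diff_conv_add_uminus, subst degree_add_eq_left) (auto simp: degree_monom_eq)
  have lead: "lead_coeff p = 1"
    unfolding deg using assms(2) by (simp add: p_def coeff_pCons split: nat.split)
  have poly: "poly p x = x ^ Q - x" for x by (simp add: p_def poly_monom)
  have pd: "pderiv p = [:- 1:]"
    using assms(1) unfolding p_def by (simp add: pderiv_diff pderiv_monom pderiv_pCons)
  have "p \<noteq> 0" using lead by auto
  then obtain A where A: "size A = Q" "p = (\<Prod>x\<in>#A. [:-x, 1:])"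
    using alg_closed_imp_factorization[of p] deg lead by auto
  have count: "count A x \<le> 1" for x
  proof (rule ccontr)
    assume "\<not> count A x \<le> 1"
    hence "x \<in># A" "x \<in># A - {#x#}" by (simp_all flip: count_greater_zero_iff)
    then obtain R where "A = {#x, x#} + R"
      by (metis add_mset_add_single insert_DiffM union_mset_add_mset_left add.left_neutral)
    hence "p = [:-x, 1:] * ([:-x, 1:] * (\<Prod>x\<in>#R. [:-x, 1:]))" by (simp only: A(2)) simp
    hence "poly (pderiv p) x = 0" by (simp only: pderiv_mult) simp
    thus False using pd by simp
  qed
  have "card (set_mset A) = (\<Sum>x\<in>set_mset A. count A x)"
    unfolding card_eq_sum
  proof (rule sum.cong)
    fix x assume "x \<in># A"
    thus "1 = count A x" using count[of x] by (simp flip: count_greater_zero_iff)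
  qed simp
  also have "\<dots> = size A" by (simp add: size_multiset_overloaded_eq)
  finally have "card (set_mset A) = size A" .
  moreover have "set_mset A = {x. x ^ Q = x}"
  proof -
    have "x \<in># A \<longleftrightarrow> poly p x = 0" for x
      by (auto simp: A(2) poly_prod_mset prod_mset_zero_iff)
    thus ?thesis using poly by auto
  qed
  ultimately show ?thesis using A(1) by simp
qed

locale finite_field_vector_space_pair =
  vs1: finite_field_vector_space s1 + vs2: finite_field_vector_space s2
  for s1 :: "'a::{field,finite} \<Rightarrow> 'b::ab_group_add \<Rightarrow> 'b" and s2 :: "'a \<Rightarrow> 'c::ab_group_add \<Rightarrow> 'c"
begin

sublocale vector_space_pair s1 s2 ..

lemma subspace_iso:
  assumes "vs1.subspace S" "finite S" "vs2.subspace T" "finite T" "card S = card T"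
  obtains f where "Vector_Spaces.linear s1 s2 f" "inj_on f S" "f ` S = T"
proof -
  obtain B where B: "B \<subseteq> S" "finite B" "vs1.independent B" "vs1.span B = S" "card B = vs1.dim S"
    using vs1.finite_subspace_basis[OF assms(1,2)] by metis
  obtain C where C: "C \<subseteq> T" "finite C" "vs2.independent C" "vs2.span C = T" "card C = vs2.dim T"
    using vs2.finite_subspace_basis[OF assms(3,4)] by metis
  have "CARD('a) ^ vs1.dim S = CARD('a) ^ vs2.dim T"
    using vs1.card_subspace[OF assms(1,2)] vs2.card_subspace[OF assms(3,4)] assms(5) by simp
  hence "vs1.dim S = vs2.dim T" using vs1.card_field_ge_2 by simp
  thus ?thesis
    using finite_basis_to_basis_subspace_isomorphism[OF assms(1,3) _ B(2,1,3) _ B(5) C(2,1,3) _ C(5)] B(4) C(4) that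
    by blast
qed

end

global_interpretation ffvs: finite_field_vector_space "fscale :: 'a::{field,finite} \<Rightarrow> _" ..

text \<open>The algebraic closure as a vector space over \<open>'a\<close>; every extension field
  needed lives inside this one type as a set.\<close>

definition ac_scale :: "'a::field \<Rightarrow> 'a alg_closure \<Rightarrow> 'a alg_closure" where
  "ac_scale c x = to_ac c * x"

definition ac_scale2 :: "'a::field \<Rightarrow> 'a alg_closure \<times> 'a alg_closure \<Rightarrow> 'a alg_closure \<times> 'a alg_closure" where
  "ac_scale2 c p = (to_ac c * fst p, to_ac c * snd p)"

global_interpretation acs: finite_field_vector_space "ac_scale :: 'a::{field,finite} \<Rightarrow> _"
  by unfold_locales (simp_all add: ac_scale_def algebra_simps)

global_interpretation acs2: finite_field_vector_space "ac_scale2 :: 'a::{field,finite} \<Rightarrow> _"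
  by unfold_locales
    (simp_all only: ac_scale2_def plus_prod_def fst_conv snd_conv to_ac_add to_ac_mult to_ac_1
      distrib_left distrib_right mult.assoc mult_1_left prod.collapse)

global_interpretation fvs_acs2:
  finite_field_vector_space_pair "fscale :: 'a::{field,finite} \<Rightarrow> _" ac_scale2 ..

global_interpretation fvs_fvs: finite_field_vector_space_pair "fscale :: 'a::{field,finite} \<Rightarrow> _" fscale ..

text \<open>The subfield consists of the solutions of x^Q = x with Q = q^a. It is closed under
  addition because Q is a power of the characteristic, and under scalars because c^q = c in
  \<open>'a\<close>. Division by 0 needs no exception, as its value is 0.\<close>

lemma ex_subfield_alg_closure:
  assumes "primepow CARD('a::{field,finite})" "1 \<le> a"
  obtains F :: "'a::{field,finite} alg_closure set" where "acs.subspace F" "finite F" "card F = CARD('a) ^ a"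
    "\<And>x y. x \<in> F \<Longrightarrow> y \<in> F \<Longrightarrow> x * y \<in> F" "\<And>x y. x \<in> F \<Longrightarrow> y \<in> F \<Longrightarrow> x / y \<in> F"
proof -
  define Q where "Q = CARD('a) ^ a"
  define F where "F = {x :: 'a alg_closure. x ^ Q = x}"
  obtain e where e: "CARD('a) = CHAR('a) ^ e" "prime CHAR('a)"
    using CARD_eq_CHAR_power[OF assms(1)] .
  have "2 ^ 1 \<le> (2::nat) ^ a" using assms(2) by (intro power_increasing) auto
  also have "\<dots> \<le> Q" unfolding Q_def using ffvs.card_field_ge_2 by (intro power_mono) auto
  finally have Q2: "2 \<le> Q" by simp
  have Qe: "Q = CHAR('a alg_closure) ^ (e * a)" by (simp add: Q_def e(1) power_mult)
  have "e * a \<noteq> 0" using Q2 Qe by (intro notI) simp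
  hence "CHAR('a alg_closure) dvd Q" unfolding Qe by (intro dvd_power) auto
  hence "card F = Q" unfolding F_def using Q2
    by (intro card_power_fixed_points) (simp_all only: of_nat_eq_0_iff_char_dvd)
  moreover from this have "finite F" using Q2 card_ge_0_finite[of F] by simp
  moreover have "acs.subspace F"
  proof (rule acs.subspaceI)
    show "0 \<in> F" using Q2 by (simp add: F_def)
    show "x + y \<in> F" if "x \<in> F" "y \<in> F" for x y
      using that freshmans_dream'[OF _ Qe, of x y] e(2) by (simp add: F_def)
    have "c ^ Q = c" for c :: 'a
      unfolding Q_def by (induction a) (simp_all add: power_mult finite_field_power_CARD)
    thus "ac_scale c x \<in> F" if "x \<in> F" for c :: 'a and x
      using that by (simp add: ac_scale_def F_def power_mult_distrib flip: to_ac_power)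
  qed
  ultimately show ?thesis
    using that[of F] by (auto simp: Q_def F_def power_mult_distrib power_divide)
qed

text \<open>Arbitrary subspaces in place of \<open>coord_space n\<close> allow members to be
  partitioned again, and nonzero vectors in place of lines simplify the counting.\<close>

definition partition_of :: "(nat \<Rightarrow> 'a::field) set \<Rightarrow> (nat \<Rightarrow> 'a) set set \<Rightarrow> bool" where
  "partition_of V P \<longleftrightarrow> P \<subseteq> subspaces_of V \<and> (\<forall>v\<in>V - {0}. \<exists>!W. W \<in> P \<and> v \<in> W)"

lemma span_singleton_subset_iff:
  "fvs.subspace W \<Longrightarrow> fvs.span {v} \<subseteq> W \<longleftrightarrow> v \<in> W"
  by (meson empty_subsetI fvs.span_base fvs.span_minimal insertI1 insert_subset subsetD)

lemma subspace_partition_iff: "subspace_partition n P \<longleftrightarrow> partition_of (coord_space n) P"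
proof (cases "P \<subseteq> subspaces_of (coord_space n)")
  case True
  hence sub: "fvs.subspace W" if "W \<in> P" for W using that by (auto simp: subspaces_of_def)
  have "(\<exists>!W. W \<in> P \<and> fvs.span {v} \<subseteq> W) \<longleftrightarrow> (\<exists>!W. W \<in> P \<and> v \<in> W)" for v
    using sub span_singleton_subset_iff by metis
  moreover have "(\<forall>L\<in>subspaces_of (coord_space n). fvs.dim L = 1 \<longrightarrow> R L) \<longleftrightarrow>
      (\<forall>v\<in>coord_space n - {0}. R (fvs.span {v}))" for R :: "(nat \<Rightarrow> 'a) set \<Rightarrow> bool"
  proof (intro iffI ballI impI)
    fix v :: "nat \<Rightarrow> 'a"
    assume *: "\<forall>L\<in>subspaces_of (coord_space n). fvs.dim L = 1 \<longrightarrow> R L" "v \<in> coord_space n - {0}"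
    hence "fvs.span {v} \<in> subspaces_of (coord_space n)" "fvs.dim (fvs.span {v}) = 1"
      using span_singleton_subset_iff[OF subspace_coord_space, of v n] dim_span_singleton[of v]
      by (simp_all add: subspaces_of_def)
    thus "R (fvs.span {v})" using *(1) by blast
  next
    fix L :: "(nat \<Rightarrow> 'a) set"
    assume R: "\<forall>v\<in>coord_space n - {0}. R (fvs.span {v})"
      and L: "L \<in> subspaces_of (coord_space n)" "fvs.dim L = 1"
    obtain v where "v \<noteq> 0" "L = fvs.span {v}"
      using L dim_one_eq_span unfolding subspaces_of_def by blast
    thus "R L" using R L(1) span_singleton_subset_iff[OF subspace_coord_space, of v n]
      by (auto simp: subspaces_of_def)
  qed
  ultimately show ?thesis using True by (simp add: subspace_partition_def partition_of_def)
qed (simp add: subspace_partition_def partition_of_def)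

text \<open>Identify \<open>V\<close> with \<open>F \<times> G\<close>, where \<open>F\<close> is
  the field with q^a elements and \<open>G\<close> a \<open>b\<close>-dimensional subspace of it.
  The members are \<open>F \<times> {0}\<close> and, for each x in \<open>F\<close>, the graph of
  all (x y, y) with y in \<open>G\<close>. A pair (u, y) with y nonzero lies only on the graph of u
  / y.\<close>

lemma partition_split:
  fixes V :: "(nat \<Rightarrow> 'a::{field,finite}) set"
  assumes q: "primepow CARD('a)" and V: "fvs.subspace V" "finite V" "fvs.dim V = a + b"
    and ab: "1 \<le> b" "b \<le> a"
  obtains A R where "partition_of V (insert A R)" "A \<notin> R" "fvs.dim A = a" "finite R"
    "card R = CARD('a) ^ a" "\<And>W. W \<in> R \<Longrightarrow> fvs.dim W = b"
proof -
  obtain F :: "'a alg_closure set" where F: "acs.subspace F" "finite F" "card F = CARD('a) ^ a"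
    and Fmult: "\<And>x y. x \<in> F \<Longrightarrow> y \<in> F \<Longrightarrow> x * y \<in> F"
    and Fdiv: "\<And>x y. x \<in> F \<Longrightarrow> y \<in> F \<Longrightarrow> x / y \<in> F"
    using ex_subfield_alg_closure[OF q, of a] ab by auto
  have "acs.dim {0 :: 'a alg_closure} \<le> b" "b \<le> acs.dim F"
    using acs.dim_eqI_card[OF F] ab by (simp_all add: acs.dim_zero_subspace)
  then obtain G where G: "acs.subspace G" "G \<subseteq> F" "acs.dim G = b"
    using acs.subspace_between[OF acs.subspace_single_0 F(1,2)] acs.subspace_0[OF F(1)]
    by (metis empty_subsetI insert_subset)
  have finG: "finite G" using G(2) F(2) finite_subset by blast
  have cG: "card G = CARD('a) ^ b" using acs.card_subspace[OF G(1) finG] G(3) by simp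
  have "card {0 :: 'a alg_closure} < card G"
    using cG ab(1) ffvs.card_field_ge_2[where ?'a = 'a] one_less_power[of "CARD('a)" b] by simp
  hence "\<not> G \<subseteq> {0}" using card_mono[of "{0}" G] by force
  then obtain g where g: "g \<in> G" "g \<noteq> 0" by blast
  have "acs2.subspace (F \<times> G)"
    using F(1) G(1) unfolding acs.subspace_def acs2.subspace_def by (auto simp: zero_prod_def ac_scale_def ac_scale2_def)
  moreover have "card V = card (F \<times> G)"
    using ffvs.card_subspace[OF V(1,2)] V(3) F(3) cG by (simp add: power_add card_cartesian_product)
  ultimately obtain f where f: "Vector_Spaces.linear fscale
      ac_scale2 f" "inj_on f V" "f ` V = F \<times> G"
    using fvs_acs2.subspace_iso[OF V(1,2)] F(2) finG finite_cartesian_product by metis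
  interpret f: Vector_Spaces.linear fscale ac_scale2 f
    by (rule f(1))
  define A where "A = {v\<in>V. snd (f v) = 0}"
  define C where "C = (\<lambda>x. {v\<in>V. fst (f v) = x * snd (f v)})"
  have lift: "\<exists>v\<in>V. f v = (x, y)" if "x \<in> F" "y \<in> G" for x y
    using f(3) that by (metis SigmaI imageE)
  have fV: "fst (f v) \<in> F" "snd (f v) \<in> G" if "v \<in> V" for v
    using imageI[OF that, of f] unfolding f(3) by (simp_all add: mem_Times_iff)
  have subA: "A \<in> subspaces_of V"
    using V(1) unfolding A_def subspaces_of_def fvs.subspace_def by (auto simp: f.add f.scale f.zero ac_scale2_def)
  have subC: "C x \<in> subspaces_of V" for x
    using V(1) unfolding C_def subspaces_of_def fvs.subspace_def
    by (auto simp: f.add f.scale f.zero ac_scale2_def algebra_simps)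
  have finA: "finite A" and finC: "finite (C x)" for x using V(2) by (simp_all add: A_def C_def)
  have "f ` A = F \<times> {0}"
    using lift[of _ 0] acs.subspace_0[OF G(1)] fV
    by (force simp: A_def image_iff prod_eq_iff)
  hence "card A = CARD('a) ^ a"
    using card_image[of f A] inj_on_subset[OF f(2), of A] F(3) by (auto simp: A_def card_cartesian_product)
  hence dA: "fvs.dim A = a" using subA finA by (intro ffvs.dim_eqI_card) (auto simp: subspaces_of_def)
  have dC: "fvs.dim (C x) = b" if "x \<in> F" for x
  proof -
    have "f ` C x = (\<lambda>y. (x * y, y)) ` G"
      using lift[of "x * _"] Fmult[OF that] G(2) fV
      by (force simp: C_def image_iff prod_eq_iff)
    moreover have "inj_on (\<lambda>y. (x * y, y)) G" by (auto simp: inj_on_def)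
    ultimately have "card (C x) = CARD('a) ^ b"
      using card_image[of f "C x"] inj_on_subset[OF f(2), of "C x"] cG by (auto simp: C_def card_image)
    thus ?thesis using subC finC by (intro ffvs.dim_eqI_card) (auto simp: subspaces_of_def)
  qed
  \<comment> \<open>Over a fixed nonzero \<open>g\<close> the graphs of different x have different
    points, and none of these lies in \<open>A\<close>; so no members coincide.\<close>
  have witness: "\<exists>v\<in>V. f v = (x * g, g)" if "x \<in> F" for x
    using lift Fmult[OF that] g(1) G(2) by blast
  have inj: "inj_on C F"
  proof (rule inj_onI)
    fix x y assume xy: "x \<in> F" "y \<in> F" "C x = C y"
    obtain v where v: "v \<in> V" "f v = (x * g, g)" using witness xy(1) by blast
    hence "v \<in> C x" by (simp add: C_def)
    hence "v \<in> C y" using xy(3) by simp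
    thus "x = y" using v g(2) by (simp add: C_def)
  qed
  have AC: "A \<noteq> C x" if x: "x \<in> F" for x
  proof -
    obtain v where v: "v \<in> V" "f v = (x * g, g)" using witness x by blast
    hence "v \<in> C x" "v \<notin> A" using g(2) by (simp_all add: C_def A_def)
    thus ?thesis by blast
  qed
  have "\<exists>!W. W \<in> insert A (C ` F) \<and> v \<in> W" if v: "v \<in> V - {0}" for v
  proof (cases "snd (f v) = 0")
    case True
    have "fst (f v) \<noteq> 0"
    proof
      assume "fst (f v) = 0"
      hence "f v = f 0" using True by (simp add: f.zero prod_eq_iff)
      thus False using inj_onD[OF f(2), of v 0] v fvs.subspace_0[OF V(1)] by simp
    qed
    hence "v \<notin> C x" for x using True by (simp add: C_def)
    moreover have "v \<in> A" using True v by (simp add: A_def)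
    ultimately show ?thesis by (intro ex1I[of _ A]) auto
  next
    case False
    have "v \<in> C x \<longleftrightarrow> x = fst (f v) / snd (f v)" for x
      using False v by (auto simp: C_def field_simps)
    moreover have "fst (f v) / snd (f v) \<in> F" using Fdiv fV v G(2) by blast
    moreover have "v \<notin> A" using False by (simp add: A_def)
    ultimately show ?thesis by (intro ex1I[of _ "C (fst (f v) / snd (f v))"]) auto
  qed
  moreover have "insert A (C ` F) \<subseteq> subspaces_of V" using subA subC by blast
  ultimately have "partition_of V (insert A (C ` F))"
    unfolding partition_of_def by (intro conjI ballI)
  moreover have "card (C ` F) = CARD('a) ^ a" using inj F(3) by (simp add: card_image)
  ultimately show ?thesis using that[of A "C ` F"] AC dA dC F(2) by blast
qed

lemma partition_of_refine:
  assumes "partition_of V (insert A R)" "A \<notin> R" "partition_of A P"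
  shows "partition_of V (P \<union> R)"
  unfolding partition_of_def
proof (intro conjI ballI)
  have V: "insert A R \<subseteq> subspaces_of V" "\<And>v. v \<in> V - {0} \<Longrightarrow> \<exists>!W. W \<in> insert A R \<and> v \<in> W"
    and A: "P \<subseteq> subspaces_of A" "\<And>v. v \<in> A - {0} \<Longrightarrow> \<exists>!W. W \<in> P \<and> v \<in> W"
    using assms(1,3) by (auto simp: partition_of_def)
  show "P \<union> R \<subseteq> subspaces_of V" using V(1) A(1) by (auto simp: subspaces_of_def)
  fix v assume v: "v \<in> V - {0}"
  show "\<exists>!W. W \<in> P \<union> R \<and> v \<in> W"
  proof (cases "v \<in> A")
    case True
    have "v \<notin> W" if "W \<in> R" for W using V(2)[OF v] True that assms(2) by auto
    thus ?thesis using A(2)[of v] True v by blast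
  next
    case False
    have "v \<notin> W" if "W \<in> P" for W using that A(1) False by (auto simp: subspaces_of_def)
    thus ?thesis using V(2)[OF v] False by blast
  qed
qed

lemma partition_of_trivial: "fvs.subspace V \<Longrightarrow> partition_of V {V}"
  by (auto simp: partition_of_def subspaces_of_def)

section \<open>The size of the partition obtained by repeated splitting\<close>

lemma half_split_bound:
  fixes q :: nat
  assumes "2 \<le> q" "2 \<le> t" "t < j" "j < 2 * t" "k = j + t"
  shows "(q ^ j + q ^ (j - j div 2)) * (q ^ t - 1) + q ^ (k - 2) + q ^ t \<le> q ^ k + q ^ (k - 1)"
proof -
  \<comment> \<open>\<open>j\<close> is the dimension left after splitting
    \<open>t\<close>-dimensional members off a space of dimension \<open>k\<close>, and
    \<open>h\<close> is its larger half. Then q^j + q^h is the number of members minus one.\<close>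
  define h where "h = j - j div 2"
  have "1 \<le> q ^ t" using assms by simp
  then obtain r where r: "q ^ t = Suc r" by (metis Suc_le_D One_nat_def)
  have "(q ^ j + q ^ h) * (q ^ t - 1) + (q ^ j + q ^ h) = q ^ k + q ^ (h + t)"
    unfolding r assms(5) power_add by (simp add: r algebra_simps)
  moreover have "q ^ (h + t) + q ^ (k - 2) + q ^ t \<le> q ^ (k - 1) + (q ^ j + q ^ h)"
  \<comment> \<open>The estimate \<open>h + t \<le> k - 2\<close> needs \<open>j div 2\<close> to be
    at least 2. It fails for \<open>j = 3\<close>, where both sides of the claim are equal.\<close>
  proof (cases "j = 3")
    case True
    hence "t = 2" "h = 2" "k = 5" using assms by (simp_all add: h_def)
    thus ?thesis using True by simp
  next
    case False
    hence j4: "4 \<le> j" using assms by linarith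
    hence "h + t \<le> k - 2" unfolding h_def assms(5) by linarith
    hence "q ^ (h + t) \<le> q ^ (k - 2)" using assms(1) by (intro power_increasing) auto
    moreover have "2 * q ^ (k - 2) \<le> q * q ^ (k - 2)" using assms(1) by simp
    moreover have "q * q ^ (k - 2) = q ^ (k - 1)"
      unfolding power_Suc[symmetric] using j4 assms(5) by (intro arg_cong[of _ _ "power q"]) linarith
    moreover have "q ^ t \<le> q ^ j" using assms by (intro power_increasing) auto
    ultimately show ?thesis by linarith
  qed
  ultimately show ?thesis unfolding h_def by linarith
qed

lemma recursive_split_bound:
  fixes q :: nat
  assumes "2 \<le> q" "2 \<le> t" "2 * t \<le> k - t"
    and "c * (q ^ t - 1) + q ^ (k - t - 2) + q ^ t \<le> q ^ (k - t) + q ^ (k - t - 1)"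
  shows "(q ^ (k - t) + c) * (q ^ t - 1) + q ^ (k - 2) + q ^ t \<le> q ^ k + q ^ (k - 1)"
proof -
  have "1 \<le> q ^ t" using assms by simp
  then obtain r where r: "q ^ t = Suc r" by (metis Suc_le_D One_nat_def)
  have "q ^ k = q ^ (k - t) * q ^ t" using assms(2,3) by (simp flip: power_add)
  hence "q ^ (k - t) * (q ^ t - 1) + q ^ (k - t) = q ^ k" by (simp add: r)
  moreover have "q ^ (k - t - 1) \<le> q ^ (k - 2)" using assms by (intro power_increasing) auto
  moreover have "2 * q ^ (k - 2) \<le> q * q ^ (k - 2)" using assms(1) by simp
  moreover have "q * q ^ (k - 2) = q ^ (k - 1)"
    unfolding power_Suc[symmetric] using assms(2,3) by (intro arg_cong[of _ _ "power q"]) linarith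
  ultimately show ?thesis using assms(4) unfolding add_mult_distrib by linarith
qed

text \<open>Each round splits dimension k into one \<open>A\<close> of dimension k - t and q^(k-t)
  members of dimension \<open>t\<close>. The bound uses \<open>c\<close>, the number of members
  minus one, because a split raises the number of members by a power of q.\<close>

lemma ex_small_partition:
  fixes V :: "(nat \<Rightarrow> 'a::{field,finite}) set"
  assumes "primepow CARD('a)" "2 \<le> t"
    and "fvs.subspace V" "finite V" "2 * t \<le> fvs.dim V"
  shows "\<exists>P c. partition_of V P \<and> largest_dim P t \<and> finite P \<and> card P \<le> Suc c \<and>
    c * (CARD('a) ^ t - 1) + CARD('a) ^ (fvs.dim V - 2) + CARD('a) ^ t
      \<le> CARD('a) ^ fvs.dim V + CARD('a) ^ (fvs.dim V - 1)"
  using assms(3-5)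
proof (induction "fvs.dim V" arbitrary: V rule: less_induct)
  case less
  define k where "k = fvs.dim V"
  define q where "q = CARD('a)"
  have q2: "2 \<le> q" using ffvs.card_field_ge_2[where ?'a = 'a] by (simp add: q_def)
  have kt: "2 * t \<le> k" using less.prems by (simp add: k_def)
  have "fvs.dim V = (k - t) + t" "1 \<le> t" "t \<le> k - t"
    using less.prems(3) assms(2) by (simp_all add: k_def)
  then obtain A R where AR: "partition_of V (insert A R)" "A \<notin> R" "fvs.dim A = k - t" "finite R"
      "card R = q ^ (k - t)" and Rt: "\<And>W. W \<in> R \<Longrightarrow> fvs.dim W = t"
    using partition_split[OF assms(1) less.prems(1,2)] unfolding q_def by metis
  have A: "fvs.subspace A" "A \<subseteq> V" using AR(1) by (auto simp: partition_of_def subspaces_of_def)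
  have finA: "finite A" using A(2) less.prems(2) finite_subset by blast
  have "R \<noteq> {}" using AR(4,5) q2 by auto
  hence Rne: "\<exists>W\<in>R. fvs.dim W = t" using Rt by blast
  have combine: ?case
    if P: "partition_of A P" "\<And>W. W \<in> P \<Longrightarrow> fvs.dim W \<le> t" "finite P" "card P \<le> Suc c"
      and c: "(q ^ (k - t) + c) * (q ^ t - 1) + q ^ (k - 2) + q ^ t \<le> q ^ k + q ^ (k - 1)" for P c
  proof (intro exI conjI)
    show "partition_of V (P \<union> R)" using partition_of_refine AR(1,2) P(1) .
    show "largest_dim (P \<union> R) t" unfolding largest_dim_def using P(2) Rt Rne by auto
    show "finite (P \<union> R)" using P AR by simp
    show "card (P \<union> R) \<le> Suc (q ^ (k - t) + c)"
      using card_Un_le[of P R] P(4) AR(5) by simp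
    show "(q ^ (k - t) + c) * (CARD('a) ^ t - 1) + CARD('a) ^ (fvs.dim V - 2) + CARD('a) ^ t
      \<le> CARD('a) ^ fvs.dim V + CARD('a) ^ (fvs.dim V - 1)"
      using c unfolding q_def k_def .
  qed
  \<comment> \<open>If \<open>A\<close> has dimension t it is kept; strictly between t and 2t it is
    halved, with halves of dimension at most t; otherwise induction applies to it.\<close>
  consider "k = 2 * t" | "2 * t < k" "k < 3 * t" | "3 * t \<le> k" using kt by linarith
  thus ?case
  proof cases
    case 1
    show ?thesis
    proof (rule combine[of "{A}" 0])
      have "1 \<le> q ^ t" using q2 by simp
      then obtain r where r: "q ^ t = Suc r" by (metis Suc_le_D One_nat_def)
      have "q ^ k = q ^ t * q ^ t" unfolding 1 by (simp add: mult_2 power_add)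
      hence "q ^ t * (q ^ t - 1) + q ^ t = q ^ k" by (simp add: r)
      moreover have "q ^ (k - 2) \<le> q ^ (k - 1)" using q2 by (intro power_increasing) auto
      ultimately show "(q ^ (k - t) + 0) * (q ^ t - 1) + q ^ (k - 2) + q ^ t \<le> q ^ k + q ^ (k - 1)"
        using 1 by simp
    qed (use 1 AR A in \<open>auto intro: partition_of_trivial\<close>)
  next
    case 2
    define j where "j = k - t"
    have j: "t < j" "j < 2 * t" "k = j + t" using 2 by (auto simp: j_def)
    have "fvs.dim A = (j - j div 2) + j div 2" using AR(3) by (simp add: j_def)
    moreover have "1 \<le> j div 2" "j div 2 \<le> j - j div 2" using j(1) assms(2) by linarith+
    ultimately obtain A' R' where AR': "partition_of A (insert A' R')" "A' \<notin> R'"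
        "fvs.dim A' = j - j div 2" "finite R'" "card R' = q ^ (j - j div 2)"
        "\<And>W. W \<in> R' \<Longrightarrow> fvs.dim W = j div 2"
      using partition_split[OF assms(1) A(1) finA] unfolding q_def by metis
    show ?thesis
    proof (rule combine[of "insert A' R'" "q ^ (j - j div 2)"])
      show "fvs.dim W \<le> t" if "W \<in> insert A' R'" for W
        using that AR'(3,6) j(2) by force
      show "(q ^ (k - t) + q ^ (j - j div 2)) * (q ^ t - 1) + q ^ (k - 2) + q ^ t \<le> q ^ k + q ^ (k - 1)"
        using half_split_bound[OF q2 assms(2) j] unfolding j_def .
    qed (use AR' in \<open>auto simp: card_insert_if\<close>)
  next
    case 3
    have "k - t < fvs.dim V" "2 * t \<le> k - t" using 3 assms(2) less.prems by (auto simp: k_def)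
    then obtain P c where P: "partition_of A P" "largest_dim P t" "finite P" "card P \<le> Suc c"
      and c: "c * (q ^ t - 1) + q ^ (k - t - 2) + q ^ t \<le> q ^ (k - t) + q ^ (k - t - 1)"
      using less.hyps[of A] A(1) finA AR(3) unfolding q_def by auto
    show ?thesis
      using combine[OF P(1) _ P(3,4) recursive_split_bound[OF q2 assms(2) \<open>2 * t \<le> k - t\<close> c]] P(2)
      by (auto simp: largest_dim_def)
  qed
qed

section \<open>Comparing the two minima\<close>

lemma sigma_le:
  "subspace_partition n (P :: (nat \<Rightarrow> 'a::{field,finite}) set set) \<Longrightarrow> largest_dim P t \<Longrightarrow>
    sigma TYPE('a) n t \<le> card P"
  unfolding sigma_def by (rule Least_le) blast

lemma sigma_attained:
  assumes "1 \<le> t" "t \<le> n"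
  obtains P :: "(nat \<Rightarrow> 'a::{field,finite}) set set"
  where "subspace_partition n P" "largest_dim P t" "card P = sigma TYPE('a) n t"
proof -
  have "\<exists>k. \<exists>P :: (nat \<Rightarrow> 'a) set set. subspace_partition n P \<and> largest_dim P t \<and> card P = k"
    using ex_subspace_partition[OF assms] by blast
  hence "\<exists>P :: (nat \<Rightarrow> 'a) set set. subspace_partition n P \<and> largest_dim P t \<and> card P = sigma TYPE('a) n t"
    unfolding sigma_def by (rule LeastI_ex)
  thus ?thesis using that by blast
qed

lemma tau_le:
  "maximal_partial_spread m t (S :: (nat \<Rightarrow> 'a::{field,finite}) set set) \<Longrightarrow> tau TYPE('a) m t \<le> card S"
  unfolding tau_def by (rule Least_le) blast

lemma tau_attained:
  obtains S :: "(nat \<Rightarrow> 'a::{field,finite}) set set"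
  where "maximal_partial_spread m t S" "card S = tau TYPE('a) m t"
proof -
  have "\<exists>k. \<exists>S :: (nat \<Rightarrow> 'a) set set. maximal_partial_spread m t S \<and> card S = k"
    using ex_maximal_partial_spread by blast
  hence "\<exists>S :: (nat \<Rightarrow> 'a) set set. maximal_partial_spread m t S \<and> card S = tau TYPE('a) m t"
    unfolding tau_def by (rule LeastI_ex)
  thus ?thesis using that by blast
qed

section \<open>Numerical consequences of the size bound\<close>

lemma sigma_bound:
  assumes "primepow CARD('a::{field,finite})" "2 \<le> t" "2 * t \<le> n"
  obtains c where "sigma TYPE('a) n t \<le> Suc c"
    "c * (CARD('a) ^ t - 1) + CARD('a) ^ (n - 2) + CARD('a) ^ t \<le> CARD('a) ^ n + CARD('a) ^ (n - 1)"
proof -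
  obtain P :: "(nat \<Rightarrow> 'a) set set" and c where "partition_of (coord_space n) P" "largest_dim P t" "card P \<le> Suc c"
    and c: "c * (CARD('a) ^ t - 1) + CARD('a) ^ (n - 2) + CARD('a) ^ t \<le> CARD('a) ^ n + CARD('a) ^ (n - 1)"
    using ex_small_partition[OF assms(1,2) subspace_coord_space[of n] finite_coord_space] assms(3)
    unfolding dim_coord_space by blast
  hence "sigma TYPE('a) n t \<le> Suc c" using sigma_le subspace_partition_iff le_trans by metis
  thus ?thesis using that c by blast
qed

text \<open>Here \<open>s\<close> members, \<open>y\<close> of them of dimension below
  \<open>t\<close>, cover q^n - 1 nonzero vectors. Each small member falls short of q^t - 1 by at
  least (q - 1) q^(t-1), while the size bound leaves a total slack of only (q - 1) q^(n-2).\<close>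

lemma few_small_members_arith:
  fixes q t n s y c :: nat
  assumes q: "2 \<le> q" and t: "2 \<le> t" "2 * t \<le> n"
    and count: "q ^ n \<le> (s - y) * (q ^ t - 1) + y * (q ^ (t - 1) - 1) + 1"
    and y: "y \<le> s" "s \<le> Suc c"
    and c: "c * (q ^ t - 1) + q ^ (n - 2) + q ^ t \<le> q ^ n + q ^ (n - 1)"
  shows "y \<le> q ^ (n - t - 1)"
proof (rule ccontr)
  assume "\<not> ?thesis"
  \<comment> \<open>All powers become monomials in \<open>Q\<close>, \<open>T\<close> and
    \<open>M\<close>, using (n - t - 1) + (t - 1) = n - 2; integers avoid truncated
    differences.\<close>
  define T where "T = int q ^ (t - 1)"
  define M where "M = int q ^ (n - t - 1)"
  define Q where "Q = int q"
  have Q: "2 \<le> Q" using q by (simp add: Q_def)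
  have T: "1 \<le> T" using q by (simp add: T_def)
  have pt: "int (q ^ t) = Q * T"
    using t unfolding T_def Q_def of_nat_power power_Suc[symmetric]
    by (intro arg_cong[of _ _ "power (int q)"]) linarith
  have p2: "int (q ^ (n - 2)) = M * T"
    using t unfolding T_def M_def of_nat_power power_add[symmetric]
    by (intro arg_cong[of _ _ "power (int q)"]) linarith
  have p1: "int (q ^ (n - 1)) = Q * (M * T)"
    using t unfolding p2[symmetric] Q_def of_nat_power power_Suc[symmetric]
    by (intro arg_cong[of _ _ "power (int q)"]) linarith
  have "q ^ n = q * q ^ (n - 1)" using t by (simp flip: power_Suc)
  hence p0: "int (q ^ n) = Q * (Q * (M * T))" by (simp only: of_nat_mult p1 flip: Q_def)
  have minus: "int (q ^ k - 1) = int (q ^ k) - 1" for k using q by (simp add: of_nat_diff)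
  have T': "int (q ^ (t - 1)) = T" by (simp add: T_def)
  have count': "Q * (Q * (M * T)) \<le> (int s - int y) * (Q * T - 1) + int y * (T - 1) + 1"
    using of_nat_mono[OF count, where 'a = int] y(1)
    unfolding of_nat_add of_nat_mult minus pt p0 T' of_nat_diff[OF y(1)] by simp
  have c': "int c * (Q * T - 1) + M * T + Q * T \<le> Q * (Q * (M * T)) + Q * (M * T)"
    using of_nat_mono[OF c, where 'a = int] unfolding of_nat_add of_nat_mult minus pt p0 p1 p2 .
  have "M + 1 \<le> int y"
    using \<open>\<not> y \<le> q ^ (n - t - 1)\<close> unfolding M_def by (simp flip: of_nat_power)
  hence y': "(M + 1) * ((Q - 1) * T) \<le> int y * ((Q - 1) * T)"
    using Q T by (intro mult_right_mono) auto
  have "2 * 1 \<le> Q * T" using Q T by (intro mult_mono) auto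
  hence "int s * (Q * T - 1) \<le> (int c + 1) * (Q * T - 1)"
    using y(2) by (intro mult_right_mono) auto
  hence "Q * T \<le> T" using count' c' y' by (simp add: algebra_simps)
  moreover have "2 * T \<le> Q * T" using Q T by (intro mult_right_mono) auto
  ultimately show False using T by linarith
qed

lemma card_disjoint_subspaces:
  assumes "finite P" "\<And>W. W \<in> P \<Longrightarrow> fvs.subspace W \<and> finite (W :: (nat \<Rightarrow> 'a::{field,finite}) set)"
    and "\<And>U W. U \<in> P \<Longrightarrow> W \<in> P \<Longrightarrow> U \<noteq> W \<Longrightarrow> U \<inter> W = {0}"
  shows "card (\<Union>W\<in>P. W - {0}) = (\<Sum>W\<in>P. CARD('a) ^ fvs.dim W - 1)"
proof -
  have "card (\<Union>W\<in>P. W - {0}) = (\<Sum>W\<in>P. card (W - {0}))"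
    using assms by (intro card_UN_disjoint) blast+
  also have "\<dots> = (\<Sum>W\<in>P. CARD('a) ^ fvs.dim W - 1)"
  proof (rule sum.cong)
    fix W assume "W \<in> P"
    thus "card (W - {0}) = CARD('a) ^ fvs.dim W - 1"
      using assms(2)[of W] ffvs.card_subspace[of W] fvs.subspace_0[of W] by (simp add: card_Diff_singleton)
  qed simp
  finally show ?thesis .
qed

lemma card_coord_space: "card (coord_space n :: (nat \<Rightarrow> 'a::{field,finite}) set) = CARD('a) ^ n"
  by (simp add: ffvs.card_subspace subspace_coord_space finite_coord_space dim_coord_space)

lemma card_coord_space_nonzero:
  "card (coord_space n - {0 :: nat \<Rightarrow> 'a::{field,finite}}) = CARD('a) ^ n - 1"
  by (simp add: card_Diff_singleton card_coord_space fvs.subspace_0[OF subspace_coord_space])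

section \<open>From a smallest partition to a maximal partial spread\<close>

lemma tau_le_sigma:
  assumes q: "primepow CARD('a::{field,finite})" and t: "2 \<le> t" "2 * t \<le> n"
  shows "tau TYPE('a) (n + t - 1) t \<le> sigma TYPE('a) n t"
proof -
  let ?V = "coord_space n :: (nat \<Rightarrow> 'a) set" and ?E = "coord_space (n + t - 1) :: (nat \<Rightarrow> 'a) set"
  have q2: "2 \<le> CARD('a)" by (rule ffvs.card_field_ge_2)
  obtain P0 :: "(nat \<Rightarrow> 'a) set set" where P0: "subspace_partition n P0" "largest_dim P0 t"
    "card P0 = sigma TYPE('a) n t"
    using sigma_attained t by (metis add_leD1 le_trans mult_2 one_le_numeral)
  have part: "P0 \<subseteq> subspaces_of ?V" "\<And>v. v \<in> ?V - {0} \<Longrightarrow> \<exists>!W. W \<in> P0 \<and> v \<in> W"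
    using P0(1) by (auto simp: subspace_partition_iff partition_of_def)
  \<comment> \<open>A partition may contain the zero subspace, but the enlargement argument needs a
    nonzero vector in every member.\<close>
  define P where "P = P0 - {{0}}"
  have "P0 \<subseteq> Pow ?V" using part(1) by (auto simp: subspaces_of_def)
  hence finP0: "finite P0" using finite_coord_space[of n] finite_subset by blast
  hence finP: "finite P" by (simp add: P_def)
  have P: "fvs.subspace W \<and> W \<subseteq> ?V \<and> W \<noteq> {0} \<and> fvs.dim W \<le> t" if "W \<in> P" for W
    using that part(1) P0(2) by (auto simp: P_def subspaces_of_def largest_dim_def)
  have finW: "finite W" if "W \<in> P" for W
    using P[OF that] finite_coord_space[of n] finite_subset by blast
  have disj: "U \<inter> W = {0}" if UW: "U \<in> P" "W \<in> P" "U \<noteq> W" for U W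
  proof -
    have "v = 0" if "v \<in> U" "v \<in> W" for v
      using that UW P[OF UW(1)] part(2)[of v] by (auto simp: P_def)
    moreover have "0 \<in> U" "0 \<in> W" using P UW fvs.subspace_0 by blast+
    ultimately show ?thesis by blast
  qed
  define y where "y = card {W\<in>P. fvs.dim W < t}"
  have few: "y \<le> CARD('a) ^ (n - t - 1)"
  proof -
    obtain c where c: "sigma TYPE('a) n t \<le> Suc c"
      "c * (CARD('a) ^ t - 1) + CARD('a) ^ (n - 2) + CARD('a) ^ t \<le> CARD('a) ^ n + CARD('a) ^ (n - 1)"
      using sigma_bound[OF q t] .
    let ?Sm = "{W\<in>P. fvs.dim W < t}"
    have "(\<Union>W\<in>P. W - {0}) = ?V - {0}"
    proof
      show "(\<Union>W\<in>P. W - {0}) \<subseteq> ?V - {0}" using P by blast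
      show "?V - {0} \<subseteq> (\<Union>W\<in>P. W - {0})"
      proof
        fix v assume v: "v \<in> ?V - {0}"
        then obtain W where "W \<in> P0" "v \<in> W" using part(2)[OF v] by blast
        moreover from this have "W \<in> P" using v by (auto simp: P_def)
        ultimately show "v \<in> (\<Union>W\<in>P. W - {0})" using v by blast
      qed
    qed
    hence "CARD('a) ^ n - 1 = (\<Sum>W\<in>P. CARD('a) ^ fvs.dim W - 1)"
      using card_disjoint_subspaces[OF finP _ disj] P finW by (simp add: card_coord_space_nonzero)
    also have "\<dots> = (\<Sum>W\<in>P - ?Sm. CARD('a) ^ fvs.dim W - 1) + (\<Sum>W\<in>?Sm. CARD('a) ^ fvs.dim W - 1)"
      using finP by (intro sum.subset_diff) auto
    also have "\<dots> \<le> (\<Sum>W\<in>P - ?Sm. CARD('a) ^ t - 1) + (\<Sum>W\<in>?Sm. CARD('a) ^ (t - 1) - 1)"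
      using q2 P by (intro add_mono sum_mono diff_le_mono power_increasing) auto
    also have "\<dots> = (card P - y) * (CARD('a) ^ t - 1) + y * (CARD('a) ^ (t - 1) - 1)"
      using finP by (simp add: y_def card_Diff_subset)
    finally have "CARD('a) ^ n \<le> (card P - y) * (CARD('a) ^ t - 1) + y * (CARD('a) ^ (t - 1) - 1) + 1"
      by linarith
    moreover have "y \<le> card P" using finP by (auto simp: y_def intro: card_mono)
    moreover have "card P \<le> Suc c"
      using c(1) P0(3) card_mono[OF finP0, of P] by (auto simp: P_def)
    ultimately show ?thesis using few_small_members_arith[OF q2 t _ _ _ c(2)] by blast
  qed
  have VE: "?V \<subseteq> ?E" using t by (auto simp: coord_space_def)
  have "\<exists>f. \<forall>W\<in>P. fvs.subspace (f W) \<and> f W \<subseteq> ?E \<and> f W \<inter> ?V = W \<and> fvs.dim (f W) = t \<and>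
    (\<forall>U\<in>P. U \<noteq> W \<longrightarrow> f U \<inter> f W = {0})"
    using few t unfolding y_def
    by (intro ffvs.extend_disjoint_subspaces[OF subspace_coord_space finite_coord_space _
        subspace_coord_space VE _ _ finP P disj]) (auto simp: dim_coord_space)
  then obtain f where f0: "\<forall>W\<in>P. fvs.subspace (f W) \<and> f W \<subseteq> ?E \<and> f W \<inter> ?V = W \<and> fvs.dim (f W) = t \<and>
    (\<forall>U\<in>P. U \<noteq> W \<longrightarrow> f U \<inter> f W = {0})" by (rule exE)
  have f: "fvs.subspace (f W)" "f W \<subseteq> ?E" "f W \<inter> ?V = W" "fvs.dim (f W) = t"
      "\<And>U. U \<in> P \<Longrightarrow> U \<noteq> W \<Longrightarrow> f U \<inter> f W = {0}" if "W \<in> P" for W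
    using bspec[OF f0 that] by simp_all
  have "partial_spread (n + t - 1) t (f ` P)"
    unfolding partial_spread_def
  proof (intro conjI ballI impI)
    show "f ` P \<subseteq> {W \<in> subspaces_of ?E. fvs.dim W = t}" using f by (auto simp: subspaces_of_def)
    fix U W assume "U \<in> f ` P" "W \<in> f ` P" "U \<noteq> W"
    thus "U \<inter> W = {0}" using f(5) by blast
  qed
  \<comment> \<open>A further member \<open>T\<close> would meet \<open>V\<close>, since t + n
    exceeds n + t - 1, and so would share a nonzero vector with some \<open>f W\<close>.\<close>
  moreover have "\<not> partial_spread (n + t - 1) t S'" if psub: "f ` P \<subset> S'" for S'
  proof
    assume S': "partial_spread (n + t - 1) t S'"
    obtain T where T: "T \<in> S'" "T \<notin> f ` P" using psub by blast
    hence T': "fvs.subspace T" "T \<subseteq> ?E" "fvs.dim T = t"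
      using S' by (auto simp: partial_spread_def subspaces_of_def)
    have "fvs.dim ?E < fvs.dim T + fvs.dim ?V" using T'(3) t by (simp add: dim_coord_space)
    then obtain v where v: "v \<in> T" "v \<in> ?V" "v \<noteq> 0"
      using ffvs.subspace_Int_nontrivial[OF T'(1) subspace_coord_space subspace_coord_space
          finite_coord_space T'(2) VE] by blast
    then obtain W where W: "W \<in> P0" "v \<in> W" using part(2)[of v] by blast
    hence WP: "W \<in> P" using v(3) by (auto simp: P_def)
    hence "v \<in> f W" using f(3)[OF WP] W(2) by blast
    moreover have "f W \<in> S'" "T \<noteq> f W" using psub WP T(2) by blast+
    hence "T \<inter> f W = {0}" using S' T(1) by (simp add: partial_spread_def)
    ultimately show False using v by blast
  qed
  ultimately have "maximal_partial_spread (n + t - 1) t (f ` P)"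
    unfolding maximal_partial_spread_def by blast
  hence "tau TYPE('a) (n + t - 1) t \<le> card (f ` P)" by (rule tau_le)
  also have "\<dots> \<le> card P" using finP by (rule card_image_le)
  also have "\<dots> \<le> card P0" using finP0 by (auto simp: P_def intro: card_mono)
  finally show ?thesis using P0(3) by simp
qed

section \<open>From a maximal partial spread to a partition\<close>

lemma sigma_le_card_spread_on:
  fixes S :: "(nat \<Rightarrow> 'a::{field,finite}) set set"
  assumes N: "fvs.subspace N" "finite N" "fvs.dim N = n" and S: "finite S"
    and sub: "\<And>U. U \<in> S \<Longrightarrow> fvs.subspace U \<and> fvs.dim (U \<inter> N) \<le> t"
    and disj: "\<And>U W. U \<in> S \<Longrightarrow> W \<in> S \<Longrightarrow> U \<noteq> W \<Longrightarrow> U \<inter> W = {0}"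
    and cover: "N - {0} \<subseteq> \<Union>S" and large: "\<exists>U\<in>S. fvs.dim (U \<inter> N) = t"
  shows "sigma TYPE('a) n t \<le> card S"
proof -
  let ?V = "coord_space n :: (nat \<Rightarrow> 'a) set"
  have "card N = card ?V"
    using N ffvs.card_subspace[OF N(1,2)] by (simp add: card_coord_space)
  then obtain f where f: "Vector_Spaces.linear fscale fscale f" "inj_on f N" "f ` N = ?V"
    using fvs_fvs.subspace_iso[OF N(1,2) subspace_coord_space finite_coord_space] by metis
  interpret f: Vector_Spaces.linear fscale fscale f by (rule f(1))
  let ?g = "\<lambda>U. f ` (U \<inter> N)"
  have gsub: "fvs.subspace (?g U)" if "U \<in> S" for U
    using sub[OF that] N(1) by (intro f.subspace_image fvs.subspace_inter) auto
  have "card (?g U) = card (U \<inter> N)" for U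
    using inj_on_subset[OF f(2)] by (intro card_image) auto
  hence dim: "fvs.dim (?g U) = fvs.dim (U \<inter> N)" if "U \<in> S" for U
    using ffvs.card_subspace[of "U \<inter> N"] sub[OF that] N gsub[OF that]
    by (intro ffvs.dim_eqI_card) (auto intro: fvs.subspace_inter)
  \<comment> \<open>The partition consists of the traces \<open>U \<inter> N\<close>, carried over
    by \<open>f\<close>. Several members may have trace \<open>{0}\<close>; such coincidences only
    lower the count.\<close>
  have "partition_of ?V (?g ` S)"
    unfolding partition_of_def
  proof (intro conjI ballI)
    show "?g ` S \<subseteq> subspaces_of ?V" using gsub f(3) by (auto simp: subspaces_of_def)
    fix v assume v: "v \<in> ?V - {0}"
    then obtain w where w: "w \<in> N" "v = f w" using f(3) by blast
    have w0: "w \<noteq> 0" using v w(2) f.zero by auto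
    then obtain U where U: "U \<in> S" "w \<in> U" using cover w(1) by blast
    have mem: "w \<in> U'" if "v \<in> ?g U'" for U'
      using that inj_onD[OF f(2)] w by auto
    show "\<exists>!W. W \<in> ?g ` S \<and> v \<in> W"
    proof (rule ex1I[of _ "?g U"])
      show "?g U \<in> ?g ` S \<and> v \<in> ?g U" using U w by blast
      fix W assume W: "W \<in> ?g ` S \<and> v \<in> W"
      then obtain U' where U': "U' \<in> S" "W = ?g U'" by blast
      hence "w \<in> U'" using W mem by blast
      hence "U' = U" using disj[OF U'(1) U(1)] U(2) w0 by blast
      thus "W = ?g U" using U'(2) by simp
    qed
  qed
  moreover have "largest_dim (?g ` S) t" using large sub dim by (auto simp: largest_dim_def)
  ultimately have "sigma TYPE('a) n t \<le> card (?g ` S)"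
    by (intro sigma_le) (simp_all add: subspace_partition_iff)
  also have "\<dots> \<le> card S" using S by (rule card_image_le)
  finally show ?thesis .
qed

text \<open>Subspaces of dimension at most \<open>t - 1\<close> have less than 1 / q of the nonzero
  vectors of a \<open>t\<close>-dimensional one, so covering q^n - 1 vectors would need
  \<open>c * (q ^ t - 1)\<close> to be at least q (q^n - 1), beyond the size bound.\<close>

lemma large_member_arith:
  fixes q t n c :: nat
  assumes "2 \<le> q" "2 \<le> t" "2 * t \<le> n" "q ^ n - 1 \<le> c * (q ^ (t - 1) - 1)"
    and "c * (q ^ t - 1) + q ^ (n - 2) + q ^ t \<le> q ^ n + q ^ (n - 1)"
  shows False
proof -
  have "q * (q ^ (t - 1) - 1) \<le> q ^ t - 1"
    using assms(1,2) by (simp add: diff_mult_distrib2 flip: power_Suc)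
  hence "c * (q * (q ^ (t - 1) - 1)) \<le> c * (q ^ t - 1)" by (rule mult_left_mono) simp
  moreover have "q * (q ^ n - 1) \<le> c * (q * (q ^ (t - 1) - 1))"
    using mult_le_mono2[OF assms(4), of q] by (simp only: mult.left_commute)
  ultimately have "q * (q ^ n - 1) + q ^ t \<le> q ^ n + q ^ (n - 1)"
    using assms(5) by linarith
  hence "q * q ^ n + q ^ t \<le> q ^ n + q ^ (n - 1) + q"
    by (simp add: diff_mult_distrib2)
  moreover have "2 * q ^ n \<le> q * q ^ n" using assms(1) by simp
  moreover have "q ^ (n - 1) \<le> q ^ n" using assms(1) by (intro power_increasing) auto
  moreover have "q < q ^ t" using assms(1,2) power_strict_increasing[of 1 t q] by simp
  ultimately show False by linarith
qed

lemma sigma_le_tau: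
  assumes q: "primepow CARD('a::{field,finite})" and t: "2 \<le> t" "2 * t \<le> n"
  shows "sigma TYPE('a) n t \<le> tau TYPE('a) (n + t - 1) t"
proof (rule ccontr)
  assume neg: "\<not> ?thesis"
  let ?E = "coord_space (n + t - 1) :: (nat \<Rightarrow> 'a) set"
  have q2: "2 \<le> CARD('a)" by (rule ffvs.card_field_ge_2)
  obtain S :: "(nat \<Rightarrow> 'a) set set" where S: "maximal_partial_spread (n + t - 1) t S"
    "card S = tau TYPE('a) (n + t - 1) t"
    using tau_attained .
  have less: "card S < sigma TYPE('a) n t" using S(2) neg by simp
  have spread: "partial_spread (n + t - 1) t S"
    and max: "\<And>S'. S \<subset> S' \<Longrightarrow> \<not> partial_spread (n + t - 1) t S'"
    using S(1) by (auto simp: maximal_partial_spread_def)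
  have U: "fvs.subspace U" "U \<subseteq> ?E" "fvs.dim U = t" "finite U" if "U \<in> S" for U
    using spread that finite_subset[OF _ finite_coord_space] by (auto simp: partial_spread_def subspaces_of_def)
  have disj: "U \<inter> W = {0}" if "U \<in> S" "W \<in> S" "U \<noteq> W" for U W
    using spread that by (auto simp: partial_spread_def)
  have "S \<subseteq> Pow ?E" using U by blast
  hence finS: "finite S" using finite_coord_space[of "n + t - 1"] finite_subset by blast
  obtain c where c: "sigma TYPE('a) n t \<le> Suc c"
    "c * (CARD('a) ^ t - 1) + CARD('a) ^ (n - 2) + CARD('a) ^ t \<le> CARD('a) ^ n + CARD('a) ^ (n - 1)"
    using sigma_bound[OF q t] .
  have Sc: "card S \<le> c" using less c(1) by simp
  define B where "B = (\<Union>W\<in>S. W - {0})"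
  have "card B = card S * (CARD('a) ^ t - 1)"
    unfolding B_def using card_disjoint_subspaces[OF finS _ disj] U by simp
  also have "\<dots> \<le> c * (CARD('a) ^ t - 1)" using Sc by simp
  finally have cB: "card B \<le> c * (CARD('a) ^ t - 1)" .
  \<comment> \<open>The size bound is multiplied by q; its term q^t becomes q * q^t, which exceeds
    the q of the claim and gives strictness.\<close>
  have small: "CARD('a) * card B + CARD('a) + CARD('a) ^ (n - 1) < CARD('a) ^ (n + 1) + CARD('a) ^ n"
  proof -
    have "card B + CARD('a) ^ (n - 2) + CARD('a) ^ t \<le> CARD('a) ^ n + CARD('a) ^ (n - 1)"
      using cB c(2) by linarith
    hence "CARD('a) * (card B + CARD('a) ^ (n - 2) + CARD('a) ^ t)
        \<le> CARD('a) * (CARD('a) ^ n + CARD('a) ^ (n - 1))" by (rule mult_left_mono) simp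
    moreover obtain k where k: "n = Suc (Suc k)" using t le_Suc_ex[of 2 n] by auto
    have "CARD('a) ^ (n - 1) = CARD('a) * CARD('a) ^ (n - 2)"
      "CARD('a) ^ n = CARD('a) * CARD('a) ^ (n - 1)" "CARD('a) ^ (n + 1) = CARD('a) * CARD('a) ^ n"
      by (simp_all add: k)
    moreover have "CARD('a) * 1 < CARD('a) * CARD('a) ^ t"
      using q2 t one_less_power[of "CARD('a)" t] by simp
    ultimately show ?thesis unfolding distrib_left by linarith
  qed
  \<comment> \<open>A \<open>t\<close>-dimensional \<open>T\<close> missing \<open>B\<close> could
    be added to the spread, against maximality.\<close>
  have block: "T \<inter> B \<noteq> {}" if T: "fvs.subspace T" "T \<subseteq> ?E" "fvs.dim T = t" for T
  proof
    assume TB: "T \<inter> B = {}"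
    have zero: "0 \<in> T" "\<And>W. W \<in> S \<Longrightarrow> 0 \<in> W" using T U fvs.subspace_0 by blast+
    have T0: "T \<inter> W = {0}" if "W \<in> S" for W
      using TB that zero unfolding B_def by blast
    have "T \<noteq> {0}"
      using T(3) t by (auto simp: ffvs.dim_zero_subspace)
    hence "T \<notin> S" using T0[of T] by auto
    hence "S \<subset> insert T S" by blast
    moreover have "partial_spread (n + t - 1) t (insert T S)"
      unfolding partial_spread_def
    proof (intro conjI ballI impI)
      show "insert T S \<subseteq> {W \<in> subspaces_of ?E. fvs.dim W = t}"
        using T U by (auto simp: subspaces_of_def)
      fix U W assume "U \<in> insert T S" "W \<in> insert T S" "U \<noteq> W"
      thus "U \<inter> W = {0}" using T0 disj by (metis Int_commute insertE)
    qed
    ultimately show False using max by blast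
  qed
  have "\<exists>N. fvs.subspace N \<and> N \<subseteq> ?E \<and> fvs.dim N = n \<and> N - {0} \<subseteq> B"
  proof (rule ffvs.blocking_set_contains_subspace[OF subspace_coord_space finite_coord_space _ _ _ _ _ _ block small])
    show "fscale k x \<in> B" if "k \<noteq> 0" "x \<in> B" for k x
      using that U(1) fvs.subspace_scale unfolding B_def by fastforce
  qed (use t U in \<open>auto simp: B_def dim_coord_space\<close>)
  then obtain N where N: "fvs.subspace N" "N \<subseteq> ?E" "fvs.dim N = n" "N - {0} \<subseteq> B" by blast
  have finN: "finite N" using N(2) finite_coord_space finite_subset by blast
  have UN: "fvs.subspace (U \<inter> N)" "fvs.dim (U \<inter> N) \<le> t" if "U \<in> S" for U
    using U[OF that] N(1) ffvs.dim_subspace_mono[of "U \<inter> N" U] by (auto intro: fvs.subspace_inter)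
  have cover: "N - {0} \<subseteq> \<Union>S" using N(4) by (auto simp: B_def)
  \<comment> \<open>The largest trace must have dimension exactly \<open>t\<close> for the
    comparison with \<open>sigma\<close>; smaller traces alone could not cover
    \<open>N\<close>.\<close>
  have "\<exists>W\<in>S. fvs.dim (W \<inter> N) = t"
  proof (rule ccontr)
    assume "\<not> ?thesis"
    hence dim: "fvs.dim (W \<inter> N) \<le> t - 1" if "W \<in> S" for W
      using UN(2)[OF that] that by (metis Suc_pred' le_neq_implies_less less_Suc_eq_le neq0_conv le_0_eq)
    have "CARD('a) ^ n - 1 = card (N - {0})"
      using ffvs.card_subspace[OF N(1) finN] N(3) fvs.subspace_0[OF N(1)] by (simp add: card_Diff_singleton)
    also have "N - {0} = (\<Union>W\<in>S. W \<inter> N - {0})" using cover by blast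
    also have "card \<dots> \<le> (\<Sum>W\<in>S. card (W \<inter> N - {0}))" by (rule card_UN_le[OF finS])
    also have "\<dots> \<le> (\<Sum>W\<in>S. CARD('a) ^ (t - 1) - 1)"
    proof (rule sum_mono)
      fix W assume W: "W \<in> S"
      have "card (W \<inter> N) = CARD('a) ^ fvs.dim (W \<inter> N)"
        using UN(1)[OF W] finN by (intro ffvs.card_subspace) auto
      also have "\<dots> \<le> CARD('a) ^ (t - 1)" using dim[OF W] q2 by (intro power_increasing) auto
      finally show "card (W \<inter> N - {0}) \<le> CARD('a) ^ (t - 1) - 1"
        using fvs.subspace_0[OF UN(1)[OF W]] by (simp add: card_Diff_singleton)
    qed
    also have "\<dots> \<le> c * (CARD('a) ^ (t - 1) - 1)" using Sc by simp
    finally show False using large_member_arith[OF q2 t _ c(2)] by blast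
  qed
  hence "sigma TYPE('a) n t \<le> card S"
    using sigma_le_card_spread_on[OF N(1) finN N(3) finS _ disj cover] U(1) UN(2) by blast
  thus False using less by simp
qed

theorem theorem2:
  fixes q n t :: nat
  assumes "primepow q"
    and "CARD('a::{field,finite}) = q"
    and "t > 1"
    and "n \<ge> 2 * t"
  shows "tau TYPE('a) (n + t - 1) t = sigma TYPE('a) n t"
  using assms by (intro antisym tau_le_sigma sigma_le_tau) auto

end
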